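(* Let $(X,\mathrm{d}\mu)$ be a $\sigma$-finite measure space and let $\mathcal{Y}_1,\dots,\mathcal{Y}_d$ be normed lattices. Let $T:\mathcal{Y}_1\times\dots\times\mathcal{Y}_d\to\mathcal{M}(X)$ be a positive multilinear operator which saturates $X$. Assume that for some $1\le q<\infty$ and some finite constant $A$ we have $$\|T(f_1,\dots,f_d)^{1/d}\|_{L^q(X)}\le A\left(\|f_1\|_{\mathcal{Y}_1}\cdots\|f_d\|_{\mathcal{Y}_d}\right)^{1/d}$$ for all nonnegative $f_j\in\mathcal{Y}_j$, $1\le j\le d$. Assume moreover that $T$ satisfies the following structural hypothesis with a finite constant $B$: for every nonnegative $(f_1,\dots,f_d)$ in some dense subspace of $\mathcal{Y}_1\times\dots\times\mathcal{Y}_d$, there are positive linear operators $S_j:\mathcal{Y}_j\to\mathcal{M}(X)$, $1\le j\le d$ (which may depend on $(f_1,\dots,f_d)$), such that for all nonnegative $h_j\in\mathcal{Y}_j$, $$T(h_1,\dots,h_d)(x)\le S_1h_1(x)\cdots S_dh_d(x)\quad\text{for a.e. }x\in X,$$ and $$S_1f_1(x)\cdots S_df_d(x)\le B^d\,T(f_1,\dots,f_d)(x)\quad\text{for a.e. }x\in X.$$ Then for every nonnegative $M\in L^{q'}(X)$ with $\|M\|_{q'}=1$ there exist positive linear operators $R_j:\mathcal{Y}_j\to L^1(X)$, $1\le j\le d$, such that for all nonnegative $f_j\in\mathcal{Y}_j$, $$M(x)^d\,T(f_1,\dots,f_d)(x)\le R_1f_1(x)\cdots R_df_d(x)\quad\text{for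 a.e. }x\in X,$$ and, for each $j$, $$\|R_j\|_{\mathcal{Y}_j\to L^1(X)}\le AB.$$
   Context: Here $d$ is a positive integer. $\mathcal{M}(X)$ denotes the space of measurable functions on $X$. $q'$ is the conjugate exponent of $q$, $1/q+1/q'=1$ (so $q'=\infty$ if $q=1$). A normed lattice is a real vector lattice with a norm satisfying $\|f\|\le\|g\|$ whenever $|f|\le|g|$. A linear or multilinear operator into $\mathcal{M}(X)$ or $L^1(X)$ is positive if it maps nonnegative inputs to a.e. nonnegative functions. $(f_1,\dots,f_d)$ is nonnegative if every $f_j\ge 0$. $T$ saturates $X$ if for each subset $E\subseteq X$ of positive measure there exist a subset $E'\subseteq E$ of positive measure and a nonnegative $(h_1,\dots,h_d)\in\mathcal{Y}_1\times\dots\times\mathcal{Y}_d$ such that $T(h_1,\dots,h_d)>0$ a.e. on $E'$.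
   Formalization: The nonnegative members of the dense subspace are additionally required to be dense in the nonnegative tuples (automatic for sublattices; without this the claim fails, e.g. for sum-zero sequences in the l^2 norm), and the constants A and B are taken to be nonnegative. *)

theory Defs
  imports
    "HOL-Analysis.Analysis"
    "HOL-Probability.Essential_Supremum"
    "HOL-Library.Lattice_Algebras"
    "HOL-Library.FuncSet"
begin

text \<open>
  Normed lattices are given by carriers: \<open>V\<close> is a vector sublattice of an ambient vector lattice
  and \<open>N\<close> is a lattice norm on \<open>V\<close>. Nothing is assumed about \<open>N\<close> outside \<open>V\<close>. A finite family of
  normed lattices over unrelated types fits this format: embed each of them as a factor of the
  direct product of their underlying vector lattices (coordinatewise order), each factor keeping
  its own norm.
\<close>

definition normed_lattice ::
  "'y::{ordered_real_vector, lattice_ab_group_add_abs} set \<Rightarrow> ('y \<Rightarrow> real) \<Rightarrow> bool"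
  where "normed_lattice V N \<longleftrightarrow>
    subspace V \<and>
    (\<forall>f\<in>V. \<forall>g\<in>V. sup f g \<in> V \<and> inf f g \<in> V) \<and>
    (\<forall>f\<in>V. 0 \<le> N f \<and> (N f = 0 \<longleftrightarrow> f = 0)) \<and>
    (\<forall>f\<in>V. \<forall>c. N (c *\<^sub>R f) = \<bar>c\<bar> * N f) \<and>
    (\<forall>f\<in>V. \<forall>g\<in>V. N (f + g) \<le> N f + N g) \<and>
    (\<forall>f\<in>V. \<forall>g\<in>V. \<bar>f\<bar> \<le> \<bar>g\<bar> \<longrightarrow> N f \<le> N g)"

text \<open>
  A tuple \<open>(f\<^sub>1, \<dots>, f\<^sub>d)\<close> is a function on a finite index type \<open>'d\<close> with \<open>d = CARD('d)\<close>, so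
  that \<open>Pi UNIV Y\<close> is the product of the spaces \<open>Y j\<close>.
\<close>

abbreviation tuples :: "('d \<Rightarrow> 'y set) \<Rightarrow> ('d \<Rightarrow> 'y) set"
  where "tuples Y \<equiv> Pi UNIV Y"

definition nonneg_tuples :: "('d \<Rightarrow> 'y::{zero, ord} set) \<Rightarrow> ('d \<Rightarrow> 'y) set"
  where "nonneg_tuples Y = {f \<in> tuples Y. \<forall>j. 0 \<le> f j}"

text \<open>
  Density is with respect to the product topology, which for a finite index type is the topology
  of the norm \<open>f \<mapsto> max\<^sub>j N j (f j)\<close>. The subspace conditions are spelled out because the function
  type is not an instance of \<^class>\<open>real_vector\<close>.
\<close>

definition dense_in_tuples ::
  "('d \<Rightarrow> 'y::minus \<Rightarrow> real) \<Rightarrow> ('d \<Rightarrow> 'y) set \<Rightarrow> ('d \<Rightarrow> 'y) set \<Rightarrow> bool"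
  where "dense_in_tuples N D P \<longleftrightarrow>
    D \<subseteq> P \<and> (\<forall>f\<in>P. \<forall>\<epsilon>>0. \<exists>g\<in>D. \<forall>j. N j (f j - g j) < \<epsilon>)"

definition dense_subspace ::
  "('d \<Rightarrow> 'y::real_vector set) \<Rightarrow> ('d \<Rightarrow> 'y \<Rightarrow> real) \<Rightarrow> ('d \<Rightarrow> 'y) set \<Rightarrow> bool"
  where "dense_subspace Y N D \<longleftrightarrow>
    (\<lambda>_. 0) \<in> D \<and>
    (\<forall>f\<in>D. \<forall>g\<in>D. (\<lambda>j. f j + g j) \<in> D) \<and>
    (\<forall>f\<in>D. \<forall>c. (\<lambda>j. c *\<^sub>R f j) \<in> D) \<and>
    dense_in_tuples N D (tuples Y)"

text \<open>
  Elements of \<open>\<M>(X)\<close> and of \<open>L\<^sup>p(X)\<close> are represented by real-valued measurable functions; since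
  these stand for their classes modulo null sets, linearity and positivity of operators into these
  spaces hold almost everywhere.
\<close>

definition positive_linear_op ::
  "'a measure \<Rightarrow> 'y::ordered_real_vector set \<Rightarrow> ('y \<Rightarrow> 'a \<Rightarrow> real) \<Rightarrow> bool"
  where "positive_linear_op \<mu> V S \<longleftrightarrow>
    (\<forall>f\<in>V. S f \<in> borel_measurable \<mu>) \<and>
    (\<forall>f\<in>V. \<forall>g\<in>V. AE x in \<mu>. S (f + g) x = S f x + S g x) \<and>
    (\<forall>f\<in>V. \<forall>c. AE x in \<mu>. S (c *\<^sub>R f) x = c * S f x) \<and>
    (\<forall>f\<in>V. 0 \<le> f \<longrightarrow> (AE x in \<mu>. 0 \<le> S f x))"

definition positive_multilinear_op ::
  "'a measure \<Rightarrow> ('d \<Rightarrow> 'y::ordered_real_vector set) \<Rightarrow> (('d \<Rightarrow> 'y) \<Rightarrow> 'a \<Rightarrow> real) \<Rightarrow> bool"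
  where "positive_multilinear_op \<mu> Y T \<longleftrightarrow>
    (\<forall>f\<in>tuples Y. T f \<in> borel_measurable \<mu>) \<and>
    (\<forall>f\<in>tuples Y. \<forall>j. \<forall>g\<in>Y j.
       AE x in \<mu>. T (f(j := f j + g)) x = T f x + T (f(j := g)) x) \<and>
    (\<forall>f\<in>tuples Y. \<forall>j c. AE x in \<mu>. T (f(j := c *\<^sub>R f j)) x = c * T f x) \<and>
    (\<forall>f\<in>nonneg_tuples Y. AE x in \<mu>. 0 \<le> T f x)"

definition saturates ::
  "'a measure \<Rightarrow> ('d \<Rightarrow> 'y::ordered_real_vector set) \<Rightarrow> (('d \<Rightarrow> 'y) \<Rightarrow> 'a \<Rightarrow> real) \<Rightarrow> bool"
  where "saturates \<mu> Y T \<longleftrightarrow>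
    (\<forall>E\<in>sets \<mu>. emeasure \<mu> E > 0 \<longrightarrow>
       (\<exists>E'\<in>sets \<mu>. E' \<subseteq> E \<and> emeasure \<mu> E' > 0 \<and>
          (\<exists>h\<in>nonneg_tuples Y. AE x in \<mu>. x \<in> E' \<longrightarrow> 0 < T h x)))"

text \<open>
  Lebesgue spaces for exponents \<open>1 \<le> p \<le> \<infinity>\<close>. The norm is real-valued and meaningful only for
  members of the space.
\<close>

definition Lp_space :: "'a measure \<Rightarrow> ennreal \<Rightarrow> ('a \<Rightarrow> real) set"
  where "Lp_space \<mu> p =
    (if p = top then {f \<in> borel_measurable \<mu>. esssup \<mu> (\<lambda>x. ennreal \<bar>f x\<bar>) < top}
     else {f \<in> borel_measurable \<mu>. integrable \<mu> (\<lambda>x. \<bar>f x\<bar> powr enn2real p)})"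

definition Lp_norm :: "'a measure \<Rightarrow> ennreal \<Rightarrow> ('a \<Rightarrow> real) \<Rightarrow> real"
  where "Lp_norm \<mu> p f =
    (if p = top then enn2real (esssup \<mu> (\<lambda>x. ennreal \<bar>f x\<bar>))
     else (\<integral>x. \<bar>f x\<bar> powr enn2real p \<partial>\<mu>) powr (1 / enn2real p))"

text \<open>
  Operator norm of an operator \<open>R\<close> that maps \<open>V\<close> into \<open>L\<^sup>1\<close>; the value \<open>top\<close> means unbounded.
\<close>

definition L1_op_norm ::
  "'a measure \<Rightarrow> 'y set \<Rightarrow> ('y \<Rightarrow> real) \<Rightarrow> ('y \<Rightarrow> 'a \<Rightarrow> real) \<Rightarrow> ennreal"
  where "L1_op_norm \<mu> V N R = (SUP f\<in>{f \<in> V. N f \<le> 1}. ennreal (Lp_norm \<mu> 1 (R f)))"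

text \<open>
  The structural hypothesis is required at the nonnegative members of a dense subspace \<open>D\<close>.
  Density of \<open>D\<close> alone would be too weak for the second inequality to have content: a dense subspace may contain no
  nonnegative tuple except \<open>0\<close> (for instance, finitely supported sequences with sum \<open>0\<close> in
  \<open>\<ell>\<^sup>2\<close>). The nonnegative members of \<open>D\<close> are therefore understood to be dense in the
  nonnegative tuples; this is automatic if \<open>D\<close> is a sublattice.
\<close>

definition structural_hypothesis ::
  "'a measure \<Rightarrow> ('d::finite \<Rightarrow> 'y::ordered_real_vector set) \<Rightarrow> ('d \<Rightarrow> 'y \<Rightarrow> real) \<Rightarrow>
    (('d \<Rightarrow> 'y) \<Rightarrow> 'a \<Rightarrow> real) \<Rightarrow> real \<Rightarrow> bool"
  where "structural_hypothesis \<mu> Y N T B \<longleftrightarrow>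
    (\<exists>D. dense_subspace Y N D \<and>
       dense_in_tuples N (D \<inter> nonneg_tuples Y) (nonneg_tuples Y) \<and>
       (\<forall>f\<in>D \<inter> nonneg_tuples Y. \<exists>S.
          (\<forall>j. positive_linear_op \<mu> (Y j) (S j)) \<and>
          (\<forall>h\<in>nonneg_tuples Y. AE x in \<mu>. T h x \<le> (\<Prod>j\<in>UNIV. S j (h j) x)) \<and>
          (AE x in \<mu>. (\<Prod>j\<in>UNIV. S j (f j) x) \<le> B ^ CARD('d) * T f x)))"

end

theory Submission
  imports Defs "HOL-Library.Function_Algebras"
begin

text \<open>
  It suffices to find operators with \<open>d M T(f)\<^sup>1\<^sup>/\<^sup>d \<le> \<Sum>\<^sub>j R\<^sub>j f\<^sub>j\<close>: replacing \<open>f\<^sub>j\<close> by \<open>a\<^sub>j f\<^sub>j\<close> and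
  optimising over \<open>a\<close> turns the arithmetic mean into the geometric one. In integrated form, with
  \<open>\<rho>\<^sub>j(h, E)\<close> in place of \<open>\<integral>\<^sub>E R\<^sub>j h\<close>, this is a system of linear inequalities for positive functionals.
  By the Hahn--Banach theorem it is solvable if \<open>d \<Sum>\<^sub>i \<integral>\<^sub>E\<^sub>i M T(h\<^sub>i)\<^sup>1\<^sup>/\<^sup>d \<le> A B \<Sum>\<^sub>j \<parallel>g\<^sub>j\<parallel>\<close> whenever the
  \<open>h\<^sub>i\<close> on \<open>E\<^sub>i\<close> add up to at most \<open>g\<close>. For \<open>g\<close> in the dense set the structural hypothesis and
  Hoelder's inequality for sums give \<open>\<Sum>\<^sub>i T(h\<^sub>i)\<^sup>1\<^sup>/\<^sup>d \<le> B T(g)\<^sup>1\<^sup>/\<^sup>d\<close> pointwise, and the general case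
  follows by approximation. The functionals are only finitely additive in \<open>E\<close>, but passing to the
  countably additive part is linear in \<open>\<rho>\<^sub>j\<close> and preserves lower bounds by measures, so its
  Radon--Nikodym density provides \<open>R\<^sub>j\<close>.
\<close>

section \<open>Real inequalities\<close>

text \<open>The operators of the structural hypothesis change with the tuple, and the product of d
  unknown operators is not linear in them. The additive form cures both: all \<open>R j\<close>
  together become one functional on functions from X to tuples, every choice of tuple, sets and
  decomposition is one linear constraint on it, and Hahn-Banach only asks that the constraints do
  not contradict each other. Testing on sets \<open>E\<close> keeps the constraints local, so that
  they can be read almost everywhere afterwards. The majorant by a sum of norms decouples: at a
  tuple with a single nonzero coordinate it bounds one operator alone. As for the constant,
  \<open>A\<close> comes from integrating against a weight of norm one, \<open>B\<close> is the d-th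
  root of \<open>B ^ d\<close>, and the factor d is absorbed by the arithmetic-geometric mean
  inequality for the norms. Approximation by the dense set rests on the norm bound itself: it makes
  the contribution of a tuple with one small coordinate small, on whatever set it is tested.\<close>

lemma root_add_le:
  assumes "n > 0" "0 \<le> x" "0 \<le> y"
  shows "root n (x + y) \<le> root n x + root n y"
proof -
  have "a ^ Suc m + b ^ Suc m \<le> (a + b) ^ Suc m" if "0 \<le> a" "0 \<le> b" for a b :: real and m
  proof (induction m)
    case (Suc m)
    have "a * a ^ Suc m + b * b ^ Suc m \<le> (a + b) * (a ^ Suc m + b ^ Suc m)"
      using that by (simp add: algebra_simps)
    also have "\<dots> \<le> (a + b) * (a + b) ^ Suc m"
      using Suc that by (intro mult_left_mono) auto
    finally show ?case by simp
  qed simp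
  from this[of "root n x" "root n y" "n - 1"] assms
  have "x + y \<le> (root n x + root n y) ^ n" by simp
  then have "root n (x + y) \<le> root n ((root n x + root n y) ^ n)"
    using assms by simp
  also have "\<dots> = root n x + root n y"
    using assms by (simp add: real_root_power_cancel)
  finally show ?thesis .
qed

lemma root_prod_le_mean:
  fixes y :: "'d::finite \<Rightarrow> real"
  assumes "\<And>j. 0 \<le> y j"
  shows "real CARD('d) * root CARD('d) (\<Prod>j\<in>UNIV. y j) \<le> (\<Sum>j\<in>UNIV. y j)"
proof -
  have "(\<Prod>j\<in>UNIV. y j) powr (1 / CARD('d)) \<le> (\<Sum>j\<in>UNIV. y j / CARD('d))"
    using assms by (intro arith_geom_mean) auto
  moreover have "root CARD('d) (\<Prod>j\<in>UNIV. y j) = (\<Prod>j\<in>UNIV. y j) powr (1 / CARD('d))"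
  proof (cases "(\<Prod>j\<in>UNIV. y j) = 0")
    case False
    then have "0 < (\<Prod>j\<in>UNIV. y j)" using assms by (simp add: prod_nonneg order_less_le)
    then show ?thesis by (simp add: root_powr_inverse)
  qed (simp only: real_root_zero powr_0)
  ultimately show ?thesis
    by (simp add: sum_divide_distrib[symmetric] field_simps)
qed

text \<open>Normalise every column sum to 1. The arithmetic-geometric mean inequality in each row
  then leaves a double sum equal to \<open>CARD('d)\<close>, and undoing the normalisation gives the
  claim. A column with sum 0 makes every product on the left vanish. This is Hoelder's inequality
  with d exponents, all equal to d.\<close>

lemma sum_root_prod_le:
  fixes a :: "'i \<Rightarrow> 'd::finite \<Rightarrow> real"
  assumes "finite I" and a: "\<And>i j. i \<in> I \<Longrightarrow> 0 \<le> a i j"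
  shows "(\<Sum>i\<in>I. root CARD('d) (\<Prod>j\<in>UNIV. a i j)) \<le> root CARD('d) (\<Prod>j\<in>UNIV. \<Sum>i\<in>I. a i j)"
proof (cases "\<exists>j. (\<Sum>i\<in>I. a i j) = 0")
  case True
  then obtain j where "(\<Sum>i\<in>I. a i j) = 0" by blast
  then have "\<forall>i\<in>I. a i j = 0"
    using a by (subst (asm) sum_nonneg_eq_0_iff[OF assms(1)]) auto
  then have "\<forall>i\<in>I. (\<Prod>j\<in>UNIV. a i j) = 0" by auto
  then have "(\<Sum>i\<in>I. root CARD('d) (\<Prod>j\<in>UNIV. a i j)) = (\<Sum>i\<in>I. 0)"
    by (intro sum.cong) (auto simp only: real_root_zero)
  then have "(\<Sum>i\<in>I. root CARD('d) (\<Prod>j\<in>UNIV. a i j)) = 0" by simp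
  moreover have "0 \<le> (\<Prod>j\<in>UNIV. \<Sum>i\<in>I. a i j)"
    using a by (intro prod_nonneg ballI sum_nonneg)
  ultimately show ?thesis by simp
next
  case False
  define s where "s j = (\<Sum>i\<in>I. a i j)" for j
  define d where "d = CARD('d)"
  have d: "d > 0" by (simp add: d_def)
  have s: "s j > 0" for j
    using False a sum_nonneg[of I "\<lambda>i. a i j"] unfolding s_def by (metis order_less_le)
  have "real d * (\<Sum>i\<in>I. root d (\<Prod>j\<in>UNIV. a i j / s j)) \<le> (\<Sum>i\<in>I. \<Sum>j\<in>UNIV. a i j / s j)"
    unfolding sum_distrib_left d_def using a s
    by (intro sum_mono root_prod_le_mean) (simp add: less_imp_le)
  also have "\<dots> = (\<Sum>j\<in>UNIV. \<Sum>i\<in>I. a i j / s j)" by (rule sum.swap)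
  also have "\<dots> = (\<Sum>j::'d\<in>UNIV. 1)"
    using s by (intro sum.cong) (auto simp: sum_divide_distrib[symmetric] s_def[symmetric] less_le)
  finally have "real d * (\<Sum>i\<in>I. root d (\<Prod>j\<in>UNIV. a i j / s j)) \<le> real d * 1" by (simp add: d_def)
  then have "(\<Sum>i\<in>I. root d (\<Prod>j\<in>UNIV. a i j / s j)) \<le> 1" using d by simp
  then have "(\<Sum>i\<in>I. root d (\<Prod>j\<in>UNIV. a i j)) / root d (\<Prod>j\<in>UNIV. s j) \<le> 1"
    by (simp add: prod_dividef real_root_divide sum_divide_distrib)
  moreover have "root d (\<Prod>j\<in>UNIV. s j) > 0" using d s by (simp add: prod_pos)
  ultimately show ?thesis by (simp add: d_def s_def)
qed

text \<open>Undoes the arithmetic-geometric mean inequality by optimising over countably many weights.\<close>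
lemma power_le_prod_of_rat_weights:
  fixes r :: "'d::finite \<Rightarrow> real"
  assumes t: "0 \<le> t" and r: "\<And>j. 0 \<le> r j"
    and le: "\<And>a::'d \<Rightarrow> rat. (\<And>j. 0 < a j) \<Longrightarrow>
      real CARD('d) * root CARD('d) (\<Prod>j\<in>UNIV. of_rat (a j)) * t \<le> (\<Sum>j\<in>UNIV. of_rat (a j) * r j)"
  shows "t ^ CARD('d) \<le> (\<Prod>j\<in>UNIV. r j)"
proof -
  define d where "d = CARD('d)"
  have d: "d > 0" by (simp add: d_def)
  have *: "t ^ d \<le> (\<Prod>j\<in>UNIV. r j + 2 * e)" if e: "e > 0" for e
  proof -
    \<comment> \<open>The ideal weight is \<open>1 / r j\<close>, which makes every term on the
      right equal to 1. The shift by \<open>e\<close> covers \<open>r j = 0\<close>, and the gap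
      between \<open>e\<close> and \<open>2 * e\<close> leaves room for a rational number.\<close>
    have "\<exists>q. 1 / (r j + 2 * e) < real_of_rat q \<and> real_of_rat q < 1 / (r j + e)" for j
      using r[of j] e by (intro of_rat_dense) (simp add: frac_less2)
    then obtain a where a: "\<And>j. 1 / (r j + 2 * e) < real_of_rat (a j)" "\<And>j. real_of_rat (a j) < 1 / (r j + e)"
      by metis
    have re: "r j + 2 * e > 0" "r j + e > 0" for j using r[of j] e by simp_all
    have a0: "real_of_rat (a j) > 0" for j
      using a(1)[of j] re[of j] by (meson divide_pos_pos less_trans zero_less_one)
    have "real d * root d (\<Prod>j\<in>UNIV. real_of_rat (a j)) * t \<le> (\<Sum>j\<in>UNIV. of_rat (a j) * r j)"
      unfolding d_def using a0 by (intro le) simp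
    also have "\<dots> \<le> (\<Sum>j::'d\<in>UNIV. 1)"
    proof (intro sum_mono)
      fix j show "of_rat (a j) * r j \<le> 1"
      proof -
        have "of_rat (a j) * r j \<le> 1 / (r j + e) * r j"
          using a(2)[of j] r by (intro mult_right_mono) auto
        also have "\<dots> \<le> 1" using re[of j] e by simp
        finally show ?thesis .
      qed
    qed
    finally have "root d (\<Prod>j\<in>UNIV. real_of_rat (a j)) * t \<le> 1" using d by (simp add: d_def mult.assoc)
    then have "(root d (\<Prod>j\<in>UNIV. real_of_rat (a j)) * t) ^ d \<le> 1"
      using t a0 by (intro power_le_one mult_nonneg_nonneg real_root_ge_zero prod_nonneg)
        (auto simp: less_imp_le)
    then have 1: "(\<Prod>j\<in>UNIV. real_of_rat (a j)) * t ^ d \<le> 1"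
      using d a0 by (simp add: power_mult_distrib prod_nonneg less_imp_le)
    have "(\<Prod>j\<in>UNIV. 1 / (r j + 2 * e)) \<le> (\<Prod>j\<in>UNIV. real_of_rat (a j))"
      using a re by (intro prod_mono) (auto intro: less_imp_le)
    then have "(\<Prod>j\<in>UNIV. 1 / (r j + 2 * e)) * t ^ d \<le> (\<Prod>j\<in>UNIV. real_of_rat (a j)) * t ^ d"
      using t by (intro mult_right_mono) auto
    with 1 have "t ^ d / (\<Prod>j\<in>UNIV. r j + 2 * e) \<le> 1" by (simp add: prod_dividef)
    then show ?thesis using re by (simp add: prod_pos pos_divide_le_eq)
  qed
  have "((\<lambda>e. \<Prod>j\<in>UNIV. r j + 2 * e) \<longlongrightarrow> (\<Prod>j\<in>UNIV. r j + 2 * 0)) (at_right 0)"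
    by (intro tendsto_intros)
  moreover have "eventually (\<lambda>e. t ^ d \<le> (\<Prod>j\<in>UNIV. r j + 2 * e)) (at_right 0)"
    using * by (auto simp: eventually_at_right_less intro: eventually_mono[OF eventually_at_right_less])
  ultimately show ?thesis
    using tendsto_lowerbound[of _ _ "at_right (0::real)" "t ^ d"] by (simp add: d_def[symmetric])
qed

section \<open>A Hahn--Banach theorem for convex cones\<close>

text \<open>
  A pair \<open>(v, r)\<close> in the cone stands for the constraint \<open>L v \<le> r\<close> on the functional. In a maximal
  consistent cone, either \<open>(v, s)\<close> is present or \<open>L (- v) < - s\<close> is forced, so that the infimum of
  the admissible \<open>r\<close> is odd in \<open>v\<close> and hence additive.
\<close>

definition consistent_cone :: "('v::real_vector \<times> real) set \<Rightarrow> bool" where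
  "consistent_cone W \<longleftrightarrow> (\<forall>a\<in>W. \<forall>b\<in>W. a + b \<in> W) \<and> (\<forall>a\<in>W. \<forall>c>0. c *\<^sub>R a \<in> W) \<and> (\<forall>r. (0, r) \<in> W \<longrightarrow> 0 \<le> r)"

lemma consistent_cone_add: "consistent_cone W \<Longrightarrow> a \<in> W \<Longrightarrow> b \<in> W \<Longrightarrow> a + b \<in> W"
  unfolding consistent_cone_def by simp

lemma consistent_cone_scale: "consistent_cone W \<Longrightarrow> a \<in> W \<Longrightarrow> c > 0 \<Longrightarrow> c *\<^sub>R a \<in> W"
  unfolding consistent_cone_def by simp

lemma consistent_cone_zero: "consistent_cone W \<Longrightarrow> (0, r) \<in> W \<Longrightarrow> 0 \<le> r"
  unfolding consistent_cone_def by simp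

text \<open>Take a maximal consistent cone by Zorn. If neither alternative held for
  \<open>(v, s)\<close>, the ray through it could be added: a pair \<open>(0, r)\<close> with
  \<open>r < 0\<close> in the enlarged cone would, after division by the coefficient of
  \<open>(v, s)\<close>, put some \<open>(- v, r')\<close> with \<open>r' < - s\<close> into
  \<open>W\<close>.\<close>

lemma maximal_consistent_cone:
  assumes "consistent_cone W0" "(0, 0) \<in> W0"
  obtains W where "W0 \<subseteq> W" "consistent_cone W"
    "\<And>v s. (v, s) \<in> W \<or> (\<exists>r. r < - s \<and> (- v, r) \<in> W)"
proof -
  let ?A = "{W. W0 \<subseteq> W \<and> consistent_cone W}"
  have "\<exists>W\<in>?A. \<forall>X\<in>?A. W \<subseteq> X \<longrightarrow> X = W"
  proof (rule subset_Zorn_nonempty)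
    show "?A \<noteq> {}" using assms by blast
    fix C assume "C \<noteq> {}" and C: "subset.chain ?A C"
    then have sub: "C \<subseteq> ?A" and tot: "\<And>X Y. X \<in> C \<Longrightarrow> Y \<in> C \<Longrightarrow> X \<subseteq> Y \<or> Y \<subseteq> X"
      unfolding subset_chain_def by blast+
    have "a + b \<in> \<Union>C" if "a \<in> \<Union>C" "b \<in> \<Union>C" for a b
    proof -
      from that obtain X Y where "X \<in> C" "a \<in> X" "Y \<in> C" "b \<in> Y" by blast
      with tot[of X Y] obtain Z where "Z \<in> C" "a \<in> Z" "b \<in> Z" by blast
      with sub show ?thesis unfolding consistent_cone_def by blast
    qed
    moreover have "c *\<^sub>R a \<in> \<Union>C" if "a \<in> \<Union>C" "c > 0" for a c
      using that sub unfolding consistent_cone_def by blast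
    moreover have "0 \<le> r" if "(0, r) \<in> \<Union>C" for r
      using that sub unfolding consistent_cone_def by blast
    ultimately have "consistent_cone (\<Union>C)"
      unfolding consistent_cone_def by simp
    moreover have "W0 \<subseteq> \<Union>C" using \<open>C \<noteq> {}\<close> sub by blast
    ultimately show "\<Union>C \<in> ?A" by simp
  qed
  then obtain W where "W \<in> ?A" and maxA: "\<forall>X\<in>?A. W \<subseteq> X \<longrightarrow> X = W" by (rule bexE)
  then have W: "W0 \<subseteq> W" "consistent_cone W" by simp_all
  have max: "X = W" if "W0 \<subseteq> X" "consistent_cone X" "W \<subseteq> X" for X
    using maxA that by simp
  have "(v, s) \<in> W \<or> (\<exists>r. r < - s \<and> (- v, r) \<in> W)" for v s
  proof (rule ccontr)
    assume n: "\<not> ?thesis"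
    define X where "X = {a + t *\<^sub>R (v, s) | a t. a \<in> W \<and> 0 \<le> t}"
    have XI: "a + t *\<^sub>R (v, s) \<in> X" if "a \<in> W" "0 \<le> t" for a t
      using that unfolding X_def by blast
    have WX: "W \<subseteq> X" using XI[of _ 0] by auto
    have vX: "(v, s) \<in> X" using XI[of 0 1] assms(2) W(1) by (force simp: zero_prod_def)
    have "consistent_cone X"
      unfolding consistent_cone_def
    proof (intro conjI ballI allI impI)
      fix a b assume "a \<in> X" "b \<in> X"
      then obtain x y t u where *: "a = x + t *\<^sub>R (v, s)" "b = y + u *\<^sub>R (v, s)" "x \<in> W" "y \<in> W" "0 \<le> t" "0 \<le> u"
        unfolding X_def by blast
      have "a + b = (x + y) + (t + u) *\<^sub>R (v, s)" by (simp only: * scaleR_add_left ac_simps)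
      moreover have "x + y \<in> W" using consistent_cone_add[OF W(2)] * by simp
      ultimately show "a + b \<in> X" using XI[of "x + y" "t + u"] *(5,6) by (simp only: add_nonneg_nonneg)
    next
      fix a and c :: real assume "a \<in> X" "0 < c"
      then obtain x t where *: "a = x + t *\<^sub>R (v, s)" "x \<in> W" "0 \<le> t"
        unfolding X_def by blast
      have "c *\<^sub>R a = c *\<^sub>R x + (c * t) *\<^sub>R (v, s)" by (simp only: * scaleR_add_right scaleR_scaleR)
      moreover have "c *\<^sub>R x \<in> W" using consistent_cone_scale[OF W(2)] * \<open>0 < c\<close> by simp
      ultimately show "c *\<^sub>R a \<in> X" using XI[of "c *\<^sub>R x" "c * t"] *(3) \<open>0 < c\<close> by (simp only: mult_nonneg_nonneg less_imp_le)
    next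
      fix r assume "(0, r) \<in> X"
      then obtain x y t where *: "x + t *\<^sub>R v = 0" "r = y + t * s" "(x, y) \<in> W" "0 \<le> t"
        unfolding X_def by (auto simp: scaleR_prod_def)
      show "0 \<le> r"
      proof (cases "t = 0")
        case True then show ?thesis using * consistent_cone_zero[OF W(2)] by auto
      next
        case False
        with * have t: "t > 0" by simp
        then have "((1 / t) *\<^sub>R x, y / t) \<in> W" using consistent_cone_scale[OF W(2) *(3), of "1 / t"] by simp
        moreover have "(1 / t) *\<^sub>R x = - v"
          using *(1) t by (simp add: add_eq_0_iff2)
        ultimately have "(- v, y / t) \<in> W" by simp
        with n have "\<not> y / t < - s" by blast
        then show ?thesis using t * by (simp add: field_simps)
      qed
    qed
    from max[OF order_trans[OF W(1) WX] this WX] vX n show False by simp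
  qed
  with W show ?thesis by (intro that) auto
qed

text \<open>A pair for \<open>- v\<close> bounds the admissible values for \<open>v\<close> from
  below, so on \<open>V\<close> the infimum is finite. Describing the majorant by a cone of pairs
  spares the construction of a sublinear functional as an infimum over all ways to generate a
  constraint. Outside \<open>V\<close> there may be no admissible value at all.\<close>

theorem Hahn_Banach_cone:
  fixes W0 :: "('v::real_vector \<times> real) set"
  assumes W0: "consistent_cone W0" "(0, 0) \<in> W0"
    and V: "subspace V" and dom: "\<And>v. v \<in> V \<Longrightarrow> \<exists>r. (v, r) \<in> W0"
  obtains L where "\<And>v r. v \<in> V \<Longrightarrow> (v, r) \<in> W0 \<Longrightarrow> L v \<le> r"
    "\<And>v w. v \<in> V \<Longrightarrow> w \<in> V \<Longrightarrow> L (v + w) = L v + L w"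
    "\<And>v c. v \<in> V \<Longrightarrow> L (c *\<^sub>R v) = c * (L v :: real)"
proof -
  obtain W where W: "W0 \<subseteq> W" "consistent_cone W"
    and dich: "\<And>v s. (v, s) \<in> W \<or> (\<exists>r. r < - s \<and> (- v, r) \<in> W)"
    using maximal_consistent_cone[OF W0] by blast
  define L where "L v = Inf {r. (v, r) \<in> W}" for v
  have add: "(v + w, r + s) \<in> W" if "(v, r) \<in> W" "(w, s) \<in> W" for v w r s
    using consistent_cone_add[OF W(2) that] by simp
  have scale: "(c *\<^sub>R v, c * r) \<in> W" if "(v, r) \<in> W" "c > 0" for v r c
    using consistent_cone_scale[OF W(2) that] by simp
  have ne: "{r. (v, r) \<in> W} \<noteq> {}" if "v \<in> V" for v using dom[OF that] W(1) by blast
  have neg: "- v \<in> V" if "v \<in> V" for v using V that by (simp add: subspace_neg)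
  have bdd: "bdd_below {r. (v, r) \<in> W}" if "v \<in> V" for v
  proof -
    from ne[OF neg[OF that]] obtain s where s: "(- v, s) \<in> W" by blast
    have "- s \<le> r" if "(v, r) \<in> W" for r
      using add[OF that s] consistent_cone_zero[OF W(2), of "r + s"] by simp
    then show ?thesis by (intro bdd_belowI) auto
  qed
  have L_le: "L v \<le> r" if "v \<in> V" "(v, r) \<in> W" for v r
    unfolding L_def using that bdd by (intro cInf_lower) auto
  have L_less: "\<exists>r. (v, r) \<in> W \<and> r < L v + e" if "v \<in> V" "e > 0" for v e
    using cInf_lessD[OF ne[OF that(1)], of "L v + e"] that unfolding L_def by auto
  have subadd: "L (v + w) \<le> L v + L w" if "v \<in> V" "w \<in> V" for v w
  proof (rule field_le_epsilon)
    fix e :: real assume "e > 0"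
    with L_less[OF that(1), of "e/2"] L_less[OF that(2), of "e/2"] obtain r s
      where "(v, r) \<in> W" "r < L v + e/2" "(w, s) \<in> W" "s < L w + e/2" by auto
    moreover have "v + w \<in> V" using V that by (simp add: subspace_add)
    ultimately show "L (v + w) \<le> L v + L w + e" using L_le[OF _ add, of v w r s] by simp
  qed
  have odd: "L (- v) = - L v" if "v \<in> V" for v
  proof (rule antisym)
    show "L (- v) \<le> - L v"
    proof (rule field_le_epsilon)
      fix e :: real assume "e > 0"
      then have "(v, L v - e) \<notin> W" using L_le[OF that] by fastforce
      with dich[of v "L v - e"] obtain r where "r < - (L v - e)" "(- v, r) \<in> W" by auto
      with L_le[OF neg[OF that]] show "L (- v) \<le> - L v + e" by fastforce
    qed
    have "0 \<le> L 0"
      unfolding L_def using ne[OF subspace_0[OF V]] consistent_cone_zero[OF W(2)]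
      by (intro cInf_greatest) auto
    also have "L 0 \<le> L v + L (- v)" using subadd[OF that neg[OF that]] by simp
    finally show "- L v \<le> L (- v)" by simp
  qed
  \<comment> \<open>Superadditivity is subadditivity for \<open>v = (v + w) + (- w)\<close> combined
    with oddness.\<close>
  have Ladd: "L (v + w) = L v + L w" if "v \<in> V" "w \<in> V" for v w
    using subadd[OF that] subadd[of "v + w" "- w"] odd[of w] neg[of w] that V
    by (simp add: subspace_add)
  have pos: "L (c *\<^sub>R v) \<le> c * L v" if "v \<in> V" "c > 0" for v and c :: real
  proof (rule field_le_epsilon)
    fix e :: real assume "e > 0"
    with L_less[OF that(1), of "e / c"] that obtain r where r: "(v, r) \<in> W" "r < L v + e / c" by auto
    have "L (c *\<^sub>R v) \<le> c * r" using L_le scale[OF r(1) that(2)] V that by (simp add: subspace_scale)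
    also have "\<dots> \<le> c * L v + e" using r(2) that(2) by (simp add: field_simps)
    finally show "L (c *\<^sub>R v) \<le> c * L v + e" .
  qed
  have poseq: "L (c *\<^sub>R v) = c * L v" if "v \<in> V" "c > 0" for v and c :: real
    using pos[OF that] pos[of "c *\<^sub>R v" "1 / c"] that V by (simp add: subspace_scale field_simps)
  have "L (c *\<^sub>R v) = c * L v" if "v \<in> V" for v and c :: real
  proof (cases c "0::real" rule: linorder_cases)
    case less
    have "L (c *\<^sub>R v) = L (- ((- c) *\<^sub>R v))" by simp
    also have "\<dots> = - L ((- c) *\<^sub>R v)" using V that by (intro odd) (simp add: subspace_scale subspace_neg)
    also have "\<dots> = c * L v" using poseq[of v "- c"] that less by simp
    finally show ?thesis .
  next
    case equal
    then show ?thesis using odd[OF subspace_0[OF V]] by simp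
  next
    case greater then show ?thesis using poseq that by simp
  qed
  with L_le Ladd W(1) that[of L] show ?thesis by blast
qed

section \<open>Lattice-ordered groups\<close>

text \<open>Since \<open>sup\<close> distributes over addition, the sum of the positive parts is the
  supremum of \<open>sum b J\<close> over all subsets. The induction uses its hypothesis twice: with
  the bound \<open>g - b k\<close> for the subsets that contain the new index, and with
  \<open>g\<close> for the others.\<close>

lemma sum_pos_part_le:
  fixes b :: "'i \<Rightarrow> 'y::lattice_ab_group_add"
  assumes "finite I" "\<And>J. J \<subseteq> I \<Longrightarrow> sum b J \<le> g"
  shows "(\<Sum>i\<in>I. sup (b i) 0) \<le> g"
  using assms
proof (induction I arbitrary: g rule: finite_induct)
  case empty
  then show ?case by force
next
  case (insert k I)
  have "sum b J \<le> g - b k" if "J \<subseteq> I" for J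
  proof -
    have "sum b (insert k J) = b k + sum b J"
      using insert.hyps that by (intro sum.insert) (auto intro: finite_subset)
    moreover have "sum b (insert k J) \<le> g" using that by (intro insert.prems) blast
    ultimately show ?thesis by (simp add: le_diff_eq ac_simps)
  qed
  then have "(\<Sum>i\<in>I. sup (b i) 0) \<le> g - b k" by (rule insert.IH)
  moreover have "(\<Sum>i\<in>I. sup (b i) 0) \<le> g"
    using insert.prems by (intro insert.IH) blast
  ultimately have "sup (b k + (\<Sum>i\<in>I. sup (b i) 0)) (0 + (\<Sum>i\<in>I. sup (b i) 0)) \<le> g"
    by (simp add: le_diff_eq ac_simps)
  then show ?case using insert.hyps by (simp add: add_sup_distrib_right)
qed

text \<open>Every term is lowered by the same \<open>e\<close>, yet one subtraction is enough: a
  nonempty partial sum loses \<open>e\<close> at least once and is otherwise at most the full sum.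
  Hence no factor depending on the number of terms appears. The empty partial sum is where
  \<open>0 \<le> g\<close> enters.\<close>

lemma sum_truncated_le:
  fixes a :: "'i \<Rightarrow> 'y::lattice_ab_group_add"
  assumes "finite I" "\<And>i. i \<in> I \<Longrightarrow> 0 \<le> a i" "0 \<le> e" "0 \<le> g" "sum a I \<le> g + e"
  shows "(\<Sum>i\<in>I. sup (a i - e) 0) \<le> g"
proof (rule sum_pos_part_le[OF assms(1)])
  fix J assume J: "J \<subseteq> I"
  show "(\<Sum>i\<in>J. a i - e) \<le> g"
  proof (cases "J = {}")
    case False
    then obtain k where k: "k \<in> J" by blast
    have fin: "finite J" using J assms(1) finite_subset by blast
    have "(\<Sum>i\<in>J. a i - e) = (a k - e) + (\<Sum>i\<in>J - {k}. a i - e)"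
      using k fin by (simp add: sum.remove)
    also have "\<dots> \<le> (a k - e) + (\<Sum>i\<in>J - {k}. a i)"
      using assms(3) by (intro add_left_mono sum_mono) simp
    also have "\<dots> = sum a J - e" using k fin by (simp add: sum.remove)
    also have "\<dots> \<le> sum a I - e" using J assms by (intro diff_right_mono sum_mono2) auto
    also have "\<dots> \<le> g" using assms(5) by (simp add: diff_le_eq)
    finally show ?thesis .
  qed (use assms in simp)
qed

section \<open>Densities of the absolutely continuous parts of finitely additive charges\<close>

lemma (in ring_of_sets) suminf_disjoint_le:
  fixes f :: "'a set \<Rightarrow> ennreal" and D :: "nat \<Rightarrow> 'a set"
  assumes f: "positive M f" "additive M f"
    and A: "A \<in> M" "range D \<subseteq> M" "disjoint_family D" "\<And>i. D i \<subseteq> A"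
  shows "(\<Sum>i. f (D i)) \<le> f A"
proof (rule suminf_le_const[OF summableI])
  fix n
  have "(\<Sum>i<n. f (D i)) = f (\<Union>i<n. D i)"
    using A by (intro additive_sum[OF f]) (auto simp: disjoint_family_on_def)
  also have "\<dots> \<le> f A"
    using A by (intro increasingD[OF additive_increasing[OF f]]) auto
  finally show "(\<Sum>i<n. f (D i)) \<le> f A" .
qed

text \<open>A common refinement of two partitions is summed by rows for one set function and by
  columns for the other.\<close>

lemma suminf_ennreal_2dimen_swap:
  fixes f :: "nat \<times> nat \<Rightarrow> ennreal"
  shows "(\<Sum>k. f (prod_decode k)) = (\<Sum>j. \<Sum>i. f (i, j))"
proof -
  have "(\<Sum>k. f (prod_decode k)) = (\<Sum>i. \<Sum>j. f (i, j))"
    by (rule suminf_ennreal_2dimen) simp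
  also have "\<dots> = (\<Sum>j. \<Sum>i. f (i, j))"
    using nn_integral_fst_count_space[of f] nn_integral_snd_count_space[of f]
    by (simp add: nn_integral_count_space_nat)
  finally show ?thesis .
qed

text \<open>This is the reason why the countably additive part is linear in the charge. One
  inequality holds because both infima on the left range over the same covers. For the other, nearly
  optimal covers \<open>A\<close> for \<open>f\<close> and \<open>B\<close> for \<open>g\<close> are
  replaced by their common refinement \<open>A i \<inter> B j\<close>, which by finite additivity
  and positivity increases neither sum.\<close>

lemma (in ring_of_sets) outer_measure_add:
  fixes f g :: "'a set \<Rightarrow> ennreal"
  assumes f: "positive M f" "additive M f" and g: "positive M g" "additive M g"
  shows "outer_measure M (\<lambda>E. f E + g E) X = outer_measure M f X + outer_measure M g X"
proof (rule antisym)
  show "outer_measure M f X + outer_measure M g X \<le> outer_measure M (\<lambda>E. f E + g E) X"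
    unfolding outer_measure_def[of M "\<lambda>E. f E + g E"]
  proof (rule INF_greatest)
    fix A :: "nat \<Rightarrow> 'a set" assume "A \<in> {A. range A \<subseteq> M \<and> disjoint_family A \<and> X \<subseteq> \<Union> (range A)}"
    then have A: "outer_measure M f X \<le> (\<Sum>i. f (A i))" "outer_measure M g X \<le> (\<Sum>i. g (A i))"
      unfolding outer_measure_def by (auto intro!: INF_lower)
    then show "outer_measure M f X + outer_measure M g X \<le> (\<Sum>i. f (A i) + g (A i))"
      by (subst suminf_add[symmetric]) (auto intro: add_mono)
  qed
  show "outer_measure M (\<lambda>E. f E + g E) X \<le> outer_measure M f X + outer_measure M g X"
  proof (rule ennreal_le_epsilon)
    fix e :: real
    assume "0 < e" and fin: "outer_measure M f X + outer_measure M g X < top"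
    then have "outer_measure M f X < outer_measure M f X + ennreal (e/2)"
      "outer_measure M g X < outer_measure M g X + ennreal (e/2)"
      by (auto simp: less_top[symmetric])
    from outer_measure_close[OF this(1)] outer_measure_close[OF this(2)] obtain A B
      where A: "range A \<subseteq> M" "disjoint_family A" "X \<subseteq> (\<Union>i::nat. A i)"
          "(\<Sum>i. f (A i)) < outer_measure M f X + ennreal (e/2)"
        and B: "range B \<subseteq> M" "disjoint_family B" "X \<subseteq> (\<Union>i::nat. B i)"
          "(\<Sum>i. g (B i)) < outer_measure M g X + ennreal (e/2)"
      by blast
    define C where "C k = (case prod_decode k of (i, j) \<Rightarrow> A i \<inter> B j)" for k
    have AB: "A i \<in> M" "B i \<in> M" for i using A(1) B(1) by auto
    have "C k \<in> M" for k
      unfolding C_def by (cases "prod_decode k") (simp add: Int[OF AB])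
    then have C: "range C \<subseteq> M" by blast
    have dC: "disjoint_family C"
    proof (unfold disjoint_family_on_def, intro ballI impI)
      fix k l :: nat assume "k \<noteq> l"
      then have "prod_decode k \<noteq> prod_decode l" by (simp add: prod_decode_eq)
      then show "C k \<inter> C l = {}"
        using A(2) B(2) unfolding disjoint_family_on_def C_def
        by (cases "prod_decode k"; cases "prod_decode l") (simp, blast)
    qed
    have "X \<subseteq> (\<Union>k. C k)"
    proof
      fix x assume "x \<in> X"
      with A(3) B(3) obtain i j where "x \<in> A i" "x \<in> B j" by blast
      then have "x \<in> C (prod_encode (i, j))" by (simp add: C_def)
      then show "x \<in> (\<Union>k. C k)" by blast
    qed
    with C dC have "outer_measure M (\<lambda>E. f E + g E) X \<le> (\<Sum>k. f (C k) + g (C k))"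
      unfolding outer_measure_def by (intro INF_lower) auto
    also have "\<dots> = (\<Sum>k. f (C k)) + (\<Sum>k. g (C k))"
      by (simp add: suminf_add)
    also have "(\<Sum>k. f (C k)) = (\<Sum>i. \<Sum>j. f (A i \<inter> B j))"
      using suminf_ennreal_2dimen[of "\<lambda>i. \<Sum>j. f (A i \<inter> B j)" "\<lambda>(i, j). f (A i \<inter> B j)"]
      by (simp add: C_def case_prod_unfold)
    also have "\<dots> \<le> (\<Sum>i. f (A i))"
      using AB B(2) by (intro suminf_le allI suminf_disjoint_le[OF f] summableI)
        (auto intro: Int simp: disjoint_family_on_def, blast)
    also have "(\<Sum>k. g (C k)) = (\<Sum>j. \<Sum>i. g (A i \<inter> B j))"
      using suminf_ennreal_2dimen_swap[of "\<lambda>(i, j). g (A i \<inter> B j)"]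
      by (simp add: C_def case_prod_unfold)
    also have "\<dots> \<le> (\<Sum>j. g (B j))"
      using AB A(2) by (intro suminf_le allI suminf_disjoint_le[OF g] summableI)
        (auto intro: Int simp: disjoint_family_on_def, blast)
    also have "(\<Sum>i. f (A i)) + (\<Sum>j. g (B j))
        \<le> (outer_measure M f X + ennreal (e/2)) + (outer_measure M g X + ennreal (e/2))"
      using A(4) B(4) by (intro add_mono) auto
    also have "\<dots> = outer_measure M f X + outer_measure M g X + (ennreal (e/2) + ennreal (e/2))"
      by (simp only: ac_simps)
    also have "ennreal (e/2) + ennreal (e/2) = ennreal e"
      using \<open>0 < e\<close> by (simp flip: ennreal_plus)
    finally show "outer_measure M (\<lambda>E. f E + g E) X
        \<le> outer_measure M f X + outer_measure M g X + ennreal e"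
      by (auto intro: add_mono)
  qed
qed

lemma outer_measure_mono:
  "(\<And>E. E \<in> M \<Longrightarrow> f E \<le> g E) \<Longrightarrow> outer_measure M f X \<le> outer_measure M g X"
  unfolding outer_measure_def by (intro INF_superset_mono subset_refl suminf_le) auto

lemma outer_measure_cong:
  "(\<And>E. E \<in> M \<Longrightarrow> f E = g E) \<Longrightarrow> outer_measure M f X = outer_measure M g X"
  by (intro antisym outer_measure_mono) simp_all

text \<open>Only one inequality needs the definition; the reverse is the same inequality for the
  factor \<open>1 / c\<close> and the scaled set function.\<close>

lemma outer_measure_cmult:
  assumes "c > 0"
  shows "outer_measure M (\<lambda>E. ennreal c * f E) X = ennreal c * outer_measure M f X"
proof -
  have *: "ennreal c * outer_measure M f X \<le> outer_measure M (\<lambda>E. ennreal c * f E) X" for c f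
    unfolding outer_measure_def by (auto intro!: INF_greatest mult_left_mono INF_lower)
  have cc: "ennreal c * (ennreal (1 / c) * x) = x" "ennreal (1 / c) * (ennreal c * x) = x" for x
    using assms by (simp_all add: mult.assoc[symmetric] flip: ennreal_mult)
  have "outer_measure M (\<lambda>E. ennreal c * f E) X
      = ennreal c * (ennreal (1 / c) * outer_measure M (\<lambda>E. ennreal c * f E) X)"
    by (simp add: cc)
  also have "\<dots> \<le> ennreal c * outer_measure M f X"
    using *[of "1 / c" "\<lambda>E. ennreal c * f E"] by (intro mult_left_mono) (simp_all add: cc)
  finally show ?thesis using *[of c f] by (rule antisym)
qed

text \<open>This is what a positive functional yields when evaluated on functions cut off to a set
  and identified modulo null sets: finite values, but no information along increasing sequences of
  sets.\<close>

definition ac_charge :: "'a measure \<Rightarrow> ('a set \<Rightarrow> real) \<Rightarrow> bool" where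
  "ac_charge M \<rho> \<longleftrightarrow> (\<forall>A\<in>sets M. 0 \<le> \<rho> A) \<and>
    (\<forall>A\<in>sets M. \<forall>B\<in>sets M. A \<inter> B = {} \<longrightarrow> \<rho> (A \<union> B) = \<rho> A + \<rho> B) \<and>
    (\<forall>A\<in>null_sets M. \<rho> A = 0)"

text \<open>The outer measure of a charge is its largest countably additive minorant.\<close>

definition ac_density :: "'a measure \<Rightarrow> ('a set \<Rightarrow> real) \<Rightarrow> 'a \<Rightarrow> real" where
  "ac_density M \<rho> = (SOME r. r \<in> borel_measurable M \<and> (\<forall>x. 0 \<le> r x) \<and>
    (\<forall>E\<in>sets M. (\<integral>\<^sup>+x\<in>E. ennreal (r x) \<partial>M) = outer_measure (sets M) (\<lambda>E. ennreal (\<rho> E)) E))"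

lemma ac_charge_positive_additive:
  assumes "ac_charge M \<rho>"
  shows "positive (sets M) (\<lambda>E. ennreal (\<rho> E))" "additive (sets M) (\<lambda>E. ennreal (\<rho> E))"
  using assms by (auto simp: ac_charge_def positive_def additive_def)

lemma outer_measure_le_self:
  assumes "ac_charge M \<rho>" "E \<in> sets M"
  shows "outer_measure (sets M) (\<lambda>E. ennreal (\<rho> E)) E \<le> ennreal (\<rho> E)"
proof -
  have "outer_measure (sets M) (\<lambda>E. ennreal (\<rho> E)) E
      \<le> (\<Sum>i. ennreal (\<rho> ((\<lambda>i::nat. if i = 0 then E else {}) i)))"
    unfolding outer_measure_def using assms(2)
    by (intro INF_lower) (auto simp: disjoint_family_on_def)
  also have "\<dots> = (\<Sum>i\<in>{0}. ennreal (\<rho> ((\<lambda>i::nat. if i = 0 then E else {}) i)))"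
    using assms(1) by (intro suminf_finite) (auto simp: ac_charge_def)
  finally show ?thesis by simp
qed

context sigma_finite_measure
begin

text \<open>Finite additivity of \<open>\<rho>\<close> already makes every measurable set
  Caratheodory measurable for its outer measure, which is therefore a measure on
  \<open>sets M\<close>. Being dominated by \<open>\<rho>\<close>, it is finite and vanishes on null
  sets, so Radon-Nikodym applies, and finiteness makes the density real almost everywhere.\<close>

lemma ac_density:
  assumes \<rho>: "ac_charge M \<rho>"
  shows ac_density_measurable[measurable]: "ac_density M \<rho> \<in> borel_measurable M"
    and ac_density_nonneg: "0 \<le> ac_density M \<rho> x"
    and nn_integral_ac_density: "E \<in> sets M \<Longrightarrow> (\<integral>\<^sup>+x\<in>E. ennreal (ac_density M \<rho> x) \<partial>M)
      = outer_measure (sets M) (\<lambda>E. ennreal (\<rho> E)) E"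
proof -
  let ?f = "\<lambda>E. ennreal (\<rho> E)" and ?O = "outer_measure (sets M) (\<lambda>E. ennreal (\<rho> E))"
  note f = ac_charge_positive_additive[OF \<rho>]
  have inc: "increasing (sets M) ?f" using sets.additive_increasing[OF f] .
  let ?L = "lambda_system (space M) (Pow (space M)) ?O"
  have "measure_space (space M) ?L ?O"
    by (intro sigma_algebra.caratheodory_lemma sigma_algebra_Pow
        sets.outer_measure_space_outer_measure f inc)
  from measure_down[OF this sets.sigma_algebra_axioms]
  have ms: "measure_space (space M) (sets M) ?O"
    using sets.algebra_subset_lambda_system[OF f(1) inc f(2)] .
  define \<nu> where "\<nu> = measure_of (space M) (sets M) ?O"
  have sets_\<nu>: "sets \<nu> = sets M" unfolding \<nu>_def by (simp add: sets.sigma_sets_eq)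
  have em: "emeasure \<nu> E = ?O E" if "E \<in> sets M" for E
    unfolding \<nu>_def using ms that sets.space_closed
    by (intro emeasure_measure_of_sigma) (auto simp: measure_space_def sets.sigma_algebra_axioms)
  have le: "?O E \<le> ?f E" if "E \<in> sets M" for E using outer_measure_le_self[OF \<rho> that] .
  have "absolutely_continuous M \<nu>"
    unfolding absolutely_continuous_def
  proof
    fix E assume E: "E \<in> null_sets M"
    then have "?f E = 0" using \<rho> by (simp add: ac_charge_def)
    with le[of E] em[of E] E show "E \<in> null_sets \<nu>" by (auto simp: null_sets_def sets_\<nu>)
  qed
  from Radon_Nikodym[OF this sets_\<nu>] obtain u where u[measurable]: "u \<in> borel_measurable M"
    and dens: "density M u = \<nu>" by blast
  have iu: "(\<integral>\<^sup>+x\<in>E. u x \<partial>M) = ?O E" if "E \<in> sets M" for E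
    using em[OF that] that by (simp add: dens[symmetric] emeasure_density)
  have "(\<integral>\<^sup>+x. u x \<partial>M) = (\<integral>\<^sup>+x\<in>space M. u x \<partial>M)"
    by (intro nn_integral_cong) auto
  also have "\<dots> \<le> ?f (space M)" unfolding iu[OF sets.top] by (rule le[OF sets.top])
  also have "\<dots> < \<infinity>" by simp
  finally have "AE x in M. u x \<noteq> \<infinity>" by (intro nn_integral_PInf_AE) auto
  then have "(\<integral>\<^sup>+x\<in>E. ennreal (enn2real (u x)) \<partial>M) = ?O E" if "E \<in> sets M" for E
    unfolding iu[OF that, symmetric] by (intro nn_integral_cong_AE) (auto simp: less_top)
  then have "\<exists>r. r \<in> borel_measurable M \<and> (\<forall>x. 0 \<le> r x) \<and>
      (\<forall>E\<in>sets M. (\<integral>\<^sup>+x\<in>E. ennreal (r x) \<partial>M) = ?O E)"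
    by (intro exI[of _ "\<lambda>x. enn2real (u x)"]) auto
  from someI_ex[OF this, folded ac_density_def]
  show "ac_density M \<rho> \<in> borel_measurable M" "0 \<le> ac_density M \<rho> x"
    "E \<in> sets M \<Longrightarrow> (\<integral>\<^sup>+x\<in>E. ennreal (ac_density M \<rho> x) \<partial>M) = ?O E"
    by blast+
qed

lemma integrable_ac_density:
  assumes "ac_charge M \<rho>"
  shows "integrable M (ac_density M \<rho>)" "(\<integral>x. ac_density M \<rho> x \<partial>M) \<le> \<rho> (space M)"
proof -
  have "(\<integral>\<^sup>+x. ennreal (ac_density M \<rho> x) \<partial>M) = (\<integral>\<^sup>+x\<in>space M. ennreal (ac_density M \<rho> x) \<partial>M)"
    by (intro nn_integral_cong) auto
  also have "\<dots> \<le> ennreal (\<rho> (space M))"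
    unfolding nn_integral_ac_density[OF assms sets.top] by (rule outer_measure_le_self[OF assms sets.top])
  finally have le: "(\<integral>\<^sup>+x. ennreal (ac_density M \<rho> x) \<partial>M) \<le> ennreal (\<rho> (space M))" .
  note [simp] = ac_density_nonneg[OF assms] ac_density_measurable[OF assms]
  show "integrable M (ac_density M \<rho>)"
    using le_less_trans[OF le ennreal_less_top] by (intro integrableI_nonneg) auto
  have "0 \<le> \<rho> (space M)" using assms by (simp add: ac_charge_def)
  then show "(\<integral>x. ac_density M \<rho> x \<partial>M) \<le> \<rho> (space M)"
    using enn2real_mono[OF le] by (simp add: integral_eq_nn_integral)
qed

section \<open>Comparison of densities, and linearity of the density in the charge\<close>

lemma AE_le_if_set_nn_integral_le:
  fixes u v :: "'a \<Rightarrow> real"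
  assumes int: "integrable M u" "integrable M v" and nn: "AE x in M. 0 \<le> u x" "AE x in M. 0 \<le> v x"
    and le: "\<And>E. E \<in> sets M \<Longrightarrow> (\<integral>\<^sup>+x\<in>E. ennreal (u x) \<partial>M) \<le> (\<integral>\<^sup>+x\<in>E. ennreal (v x) \<partial>M)"
  shows "AE x in M. u x \<le> v x"
proof -
  have eq: "(\<integral>\<^sup>+x\<in>E. ennreal (w x) \<partial>M) = ennreal (\<integral>x\<in>E. w x \<partial>M)" "(\<integral>x\<in>E. w x \<partial>M) \<ge> 0"
    if E: "E \<in> sets M" and w: "integrable M w" "AE x in M. 0 \<le> w x" for w :: "'a \<Rightarrow> real" and E
  proof -
    have "(\<integral>\<^sup>+x. ennreal (indicator E x *\<^sub>R w x) \<partial>M) = ennreal (\<integral>x\<in>E. w x \<partial>M)"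
      unfolding set_lebesgue_integral_def using w E
      by (intro nn_integral_eq_integral integrable_mult_indicator) (auto simp: indicator_def)
    also have "(\<integral>\<^sup>+x. ennreal (indicator E x *\<^sub>R w x) \<partial>M) = (\<integral>\<^sup>+x\<in>E. ennreal (w x) \<partial>M)"
      by (intro nn_integral_cong) (auto simp: indicator_def)
    finally show "(\<integral>\<^sup>+x\<in>E. ennreal (w x) \<partial>M) = ennreal (\<integral>x\<in>E. w x \<partial>M)" .
    show "(\<integral>x\<in>E. w x \<partial>M) \<ge> 0"
      unfolding set_lebesgue_integral_def using w(2) by (intro integral_nonneg_AE) (auto simp: indicator_def)
  qed
  have "AE x in M. 0 \<le> v x - u x"
  proof (rule density_nonneg)
    fix E assume E: "E \<in> sets M"
    have si: "set_integrable M E u" "set_integrable M E v"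
      using int E unfolding set_integrable_def by (auto simp del: real_scaleR_def intro: integrable_mult_indicator)
    have "(\<integral>x\<in>E. u x \<partial>M) \<le> (\<integral>x\<in>E. v x \<partial>M)"
      using le[OF E] eq[OF E int(1) nn(1)] eq[OF E int(2) nn(2)] by (simp add: ennreal_le_iff)
    then show "0 \<le> (\<integral>x\<in>E. v x - u x \<partial>M)"
      using si by (simp add: set_integral_diff)
  qed (use int in auto)
  then show ?thesis by simp
qed

lemma AE_eq_if_set_nn_integral_eq:
  fixes u v :: "'a \<Rightarrow> real"
  assumes int: "integrable M u" "integrable M v" and nn: "AE x in M. 0 \<le> u x" "AE x in M. 0 \<le> v x"
    and eq: "\<And>E. E \<in> sets M \<Longrightarrow> (\<integral>\<^sup>+x\<in>E. ennreal (u x) \<partial>M) = (\<integral>\<^sup>+x\<in>E. ennreal (v x) \<partial>M)"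
  shows "AE x in M. u x = v x"
proof -
  have "AE x in M. u x \<le> v x"
    by (rule AE_le_if_set_nn_integral_le[OF int nn]) (simp add: eq)
  moreover have "AE x in M. v x \<le> u x"
    by (rule AE_le_if_set_nn_integral_le[OF int(2,1) nn(2,1)]) (simp add: eq)
  ultimately show ?thesis by eventually_elim simp
qed

lemma ac_charge_add:
  "ac_charge M \<rho> \<Longrightarrow> ac_charge M \<sigma> \<Longrightarrow> ac_charge M (\<lambda>E. \<rho> E + \<sigma> E)"
  by (auto simp: ac_charge_def)

lemma ac_charge_sum:
  "finite J \<Longrightarrow> (\<And>j. j \<in> J \<Longrightarrow> ac_charge M (\<rho> j)) \<Longrightarrow> ac_charge M (\<lambda>E. \<Sum>j\<in>J. \<rho> j E)"
  by (induction rule: finite_induct) (auto simp: ac_charge_add, simp add: ac_charge_def)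

lemma ac_density_add:
  assumes \<rho>: "ac_charge M \<rho>" and \<sigma>: "ac_charge M \<sigma>"
  shows "AE x in M. ac_density M (\<lambda>E. \<rho> E + \<sigma> E) x = ac_density M \<rho> x + ac_density M \<sigma> x"
proof (rule AE_eq_if_set_nn_integral_eq)
  note \<rho>\<sigma> = ac_charge_add[OF \<rho> \<sigma>]
  note [measurable] = ac_density_measurable[OF \<rho>] ac_density_measurable[OF \<sigma>]
  show "integrable M (ac_density M (\<lambda>E. \<rho> E + \<sigma> E))"
    "integrable M (\<lambda>x. ac_density M \<rho> x + ac_density M \<sigma> x)"
    using \<rho> \<sigma> \<rho>\<sigma> by (auto intro: integrable_ac_density)
  show "AE x in M. 0 \<le> ac_density M (\<lambda>E. \<rho> E + \<sigma> E) x"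
    "AE x in M. 0 \<le> ac_density M \<rho> x + ac_density M \<sigma> x"
    using \<rho> \<sigma> \<rho>\<sigma> by (auto intro!: ac_density_nonneg add_nonneg_nonneg)
  fix E assume E[measurable]: "E \<in> sets M"
  have "(\<integral>\<^sup>+x\<in>E. ennreal (ac_density M \<rho> x + ac_density M \<sigma> x) \<partial>M)
      = (\<integral>\<^sup>+x\<in>E. ennreal (ac_density M \<rho> x) \<partial>M) + (\<integral>\<^sup>+x\<in>E. ennreal (ac_density M \<sigma> x) \<partial>M)"
    using ac_density_nonneg[OF \<rho>] ac_density_nonneg[OF \<sigma>]
    by (subst nn_integral_add[symmetric]) (auto simp: distrib_right)
  also have "\<dots> = outer_measure (sets M) (\<lambda>E. ennreal (\<rho> E) + ennreal (\<sigma> E)) E"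
    using ac_charge_positive_additive[OF \<rho>] ac_charge_positive_additive[OF \<sigma>] E
    by (simp add: nn_integral_ac_density[OF \<rho>] nn_integral_ac_density[OF \<sigma>] sets.outer_measure_add)
  also have "\<dots> = outer_measure (sets M) (\<lambda>E. ennreal (\<rho> E + \<sigma> E)) E"
    using \<rho> \<sigma> by (intro outer_measure_cong) (auto simp: ac_charge_def)
  finally show "(\<integral>\<^sup>+x\<in>E. ennreal (ac_density M (\<lambda>E. \<rho> E + \<sigma> E) x) \<partial>M)
      = (\<integral>\<^sup>+x\<in>E. ennreal (ac_density M \<rho> x + ac_density M \<sigma> x) \<partial>M)"
    using nn_integral_ac_density[OF \<rho>\<sigma> E] by simp
qed

lemma ac_density_zero: "AE x in M. ac_density M (\<lambda>_. 0) x = 0"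
proof -
  have "ac_charge M (\<lambda>_. 0)" by (simp add: ac_charge_def)
  from ac_density_add[OF this this] show ?thesis by simp
qed

lemma ac_density_sum:
  assumes "finite J" "\<And>j. j \<in> J \<Longrightarrow> ac_charge M (\<rho> j)"
  shows "AE x in M. ac_density M (\<lambda>E. \<Sum>j\<in>J. \<rho> j E) x = (\<Sum>j\<in>J. ac_density M (\<rho> j) x)"
  using assms
proof (induction rule: finite_induct)
  case empty then show ?case using ac_density_zero by simp
next
  case (insert k J)
  have "ac_charge M (\<rho> k)" "ac_charge M (\<lambda>E. \<Sum>j\<in>J. \<rho> j E)"
    using insert.prems insert.hyps by (auto intro: ac_charge_sum)
  from ac_density_add[OF this]
  have "AE x in M. ac_density M (\<lambda>E. \<Sum>j\<in>insert k J. \<rho> j E) x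
      = ac_density M (\<rho> k) x + ac_density M (\<lambda>E. \<Sum>j\<in>J. \<rho> j E) x"
    using insert.hyps by simp
  moreover have "AE x in M. ac_density M (\<lambda>E. \<Sum>j\<in>J. \<rho> j E) x = (\<Sum>j\<in>J. ac_density M (\<rho> j) x)"
    using insert by simp
  ultimately show ?case by eventually_elim (use insert.hyps in simp)
qed

lemma ac_density_cmult:
  assumes \<rho>: "ac_charge M \<rho>" and c: "0 < c"
  shows "AE x in M. ac_density M (\<lambda>E. c * \<rho> E) x = c * ac_density M \<rho> x"
proof (rule AE_eq_if_set_nn_integral_eq)
  have c\<rho>: "ac_charge M (\<lambda>E. c * \<rho> E)"
    using \<rho> c by (auto simp: ac_charge_def distrib_left)
  note [measurable] = ac_density_measurable[OF \<rho>]
  show "integrable M (ac_density M (\<lambda>E. c * \<rho> E))" "integrable M (\<lambda>x. c * ac_density M \<rho> x)"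
    using \<rho> c\<rho> by (auto intro: integrable_ac_density)
  show "AE x in M. 0 \<le> ac_density M (\<lambda>E. c * \<rho> E) x" "AE x in M. 0 \<le> c * ac_density M \<rho> x"
    using ac_density_nonneg[OF \<rho>] ac_density_nonneg[OF c\<rho>] c by simp_all
  fix E assume E[measurable]: "E \<in> sets M"
  have "(\<integral>\<^sup>+x\<in>E. ennreal (c * ac_density M \<rho> x) \<partial>M)
      = ennreal c * (\<integral>\<^sup>+x\<in>E. ennreal (ac_density M \<rho> x) \<partial>M)"
    using ac_density_nonneg[OF \<rho>] c
    by (subst nn_integral_cmult[symmetric]) (auto simp: ennreal_mult mult.assoc)
  also have "\<dots> = outer_measure (sets M) (\<lambda>E. ennreal c * ennreal (\<rho> E)) E"
    using E c by (simp add: nn_integral_ac_density[OF \<rho>] outer_measure_cmult)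
  also have "\<dots> = outer_measure (sets M) (\<lambda>E. ennreal (c * \<rho> E)) E"
    using \<rho> c by (intro outer_measure_cong) (auto simp: ac_charge_def ennreal_mult)
  finally show "(\<integral>\<^sup>+x\<in>E. ennreal (ac_density M (\<lambda>E. c * \<rho> E) x) \<partial>M)
      = (\<integral>\<^sup>+x\<in>E. ennreal (c * ac_density M \<rho> x) \<partial>M)"
    using nn_integral_ac_density[OF c\<rho> E] by simp
qed

text \<open>A measure agrees with its own outer measure, and outer measures are monotone in the set
  function. So a lower bound by the measure with density \<open>u\<close> survives the passage from
  \<open>\<rho>\<close> to its countably additive part.\<close>

lemma le_ac_density:
  fixes u :: "'a \<Rightarrow> real"
  assumes \<rho>: "ac_charge M \<rho>" and u: "integrable M u" "AE x in M. 0 \<le> u x"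
    and le: "\<And>E. E \<in> sets M \<Longrightarrow> (\<integral>x\<in>E. u x \<partial>M) \<le> \<rho> E"
  shows "AE x in M. u x \<le> ac_density M \<rho> x"
proof (rule AE_le_if_set_nn_integral_le)
  show "integrable M u" "integrable M (ac_density M \<rho>)" "AE x in M. 0 \<le> u x"
      "AE x in M. 0 \<le> ac_density M \<rho> x"
    using assms by (auto intro: integrable_ac_density ac_density_nonneg)
  fix E assume E: "E \<in> sets M"
  let ?\<nu> = "density M (\<lambda>x. ennreal (u x))"
  have [measurable]: "u \<in> borel_measurable M" using u by simp
  have nu: "emeasure ?\<nu> A \<le> ennreal (\<rho> A)" if A: "A \<in> sets M" for A
  proof -
    have "emeasure ?\<nu> A = (\<integral>\<^sup>+x. ennreal (indicator A x *\<^sub>R u x) \<partial>M)"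
      using A by (simp add: emeasure_density) (intro nn_integral_cong, auto simp: indicator_def)
    also have "\<dots> = ennreal (\<integral>x\<in>A. u x \<partial>M)"
      unfolding set_lebesgue_integral_def using u A
      by (intro nn_integral_eq_integral integrable_mult_indicator) (auto simp: indicator_def)
    finally show ?thesis using le[OF A] by (simp add: ennreal_leI)
  qed
  have "(\<integral>\<^sup>+x\<in>E. ennreal (u x) \<partial>M) = emeasure ?\<nu> E"
    using E by (simp add: emeasure_density)
  also have "\<dots> = outer_measure (sets M) (emeasure ?\<nu>) E"
    using E emeasure_positive[of ?\<nu>] emeasure_countably_additive[of ?\<nu>]
    by (intro sets.outer_measure_agrees[symmetric]) auto
  also have "\<dots> \<le> outer_measure (sets M) (\<lambda>E. ennreal (\<rho> E)) E"
    using nu by (intro outer_measure_mono)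
  also have "\<dots> = (\<integral>\<^sup>+x\<in>E. ennreal (ac_density M \<rho> x) \<partial>M)"
    using nn_integral_ac_density[OF \<rho> E] by simp
  finally show "(\<integral>\<^sup>+x\<in>E. ennreal (u x) \<partial>M) \<le> (\<integral>\<^sup>+x\<in>E. ennreal (ac_density M \<rho> x) \<partial>M)" .
qed

end

section \<open>Hoelder's inequality against a normalised weight\<close>

lemma conjugate_exponents_cases:
  fixes q q' :: ennreal
  assumes "1 \<le> q" "q < top" "1 / q + 1 / q' = 1"
  obtains "q = 1" "q' = top"
  | p p' :: real where "q = ennreal p" "q' = ennreal p'" "1 < p" "1 < p'" "1 / p + 1 / p' = 1"
proof -
  obtain p where p: "q = ennreal p" "0 \<le> p" using assms(2) by (cases q) auto
  have p1: "1 \<le> p" using assms(1) p by simp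
  have iq: "1 / q = ennreal (1 / p)" using p1 p by (simp add: divide_ennreal[symmetric])
  show thesis
  proof (cases q')
    case top
    then have "ennreal (1 / p) = ennreal 1" using assms(3) iq by simp
    then have "1 / p = 1" using p1 by (subst (asm) ennreal_inj) auto
    then have "q = 1" using p by simp
    with top show ?thesis using that(1) by simp
  next
    case (real p')
    \<comment> \<open>Division by zero gives \<open>top\<close> in \<open>ennreal\<close>, which the
      relation between the exponents excludes.\<close>
    have "p' \<noteq> 0"
    proof
      assume "p' = 0"
      then have "1 / q' = top" using real by (simp add: ennreal_divide_zero)
      then show False using assms(3) by simp
    qed
    with real have p': "0 < p'" by simp
    have "1 / q' = ennreal (1 / p')" using p' real by (simp add: divide_ennreal[symmetric])
    then have "ennreal (1 / p + 1 / p') = ennreal 1"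
      using assms(3) iq p1 p' by (simp add: ennreal_plus)
    then have e: "1 / p + 1 / p' = 1" using p1 p' by (subst (asm) ennreal_inj) auto
    have "1 / p' > 0" "1 / p > 0" using p' p1 by simp_all
    then have "1 / p < 1" "1 / p' < 1" using e by linarith+
    then have "1 < p" "1 < p'" using p' p1 by (simp_all add: divide_less_eq)
    with p real e show ?thesis using that(2) by blast
  qed
qed

lemma Hoelder_normalised:
  fixes u w :: "'a \<Rightarrow> real" and q q' :: ennreal
  assumes q: "1 \<le> q" "q < top" "1 / q + 1 / q' = 1"
    and w: "w \<in> Lp_space \<mu> q'" "AE x in \<mu>. 0 \<le> w x" "Lp_norm \<mu> q' w = 1"
    and u: "u \<in> Lp_space \<mu> q" "AE x in \<mu>. 0 \<le> u x"
  shows "integrable \<mu> (\<lambda>x. w x * u x)" "(\<integral>x. w x * u x \<partial>\<mu>) \<le> Lp_norm \<mu> q u"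
proof -
  have [measurable]: "u \<in> borel_measurable \<mu>" "w \<in> borel_measurable \<mu>"
    using u w by (auto simp: Lp_space_def split: if_splits)
  have "integrable \<mu> (\<lambda>x. w x * u x) \<and> (\<integral>x. w x * u x \<partial>\<mu>) \<le> Lp_norm \<mu> q u"
    using q
  proof (cases rule: conjugate_exponents_cases)
    case 1
    \<comment> \<open>As \<open>enn2real\<close> sends \<open>top\<close> to 0, norm 1 rules out an
      infinite essential supremum.\<close>
    have "esssup \<mu> (\<lambda>x. ennreal \<bar>w x\<bar>) = 1"
      using w(3) 1 by (cases "esssup \<mu> (\<lambda>x. ennreal \<bar>w x\<bar>)") (auto simp: Lp_norm_def)
    then have "AE x in \<mu>. ennreal \<bar>w x\<bar> \<le> 1"
      using esssup_AE[of "\<lambda>x. ennreal \<bar>w x\<bar>" \<mu>] by simp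
    then have w1: "AE x in \<mu>. \<bar>w x\<bar> \<le> 1" by (simp flip: ennreal_1)
    have "integrable \<mu> (\<lambda>x. \<bar>u x\<bar>)"
      using u 1 by (simp add: Lp_space_def)
    then have iu: "integrable \<mu> u" by (subst (asm) integrable_abs_iff) auto
    have *: "AE x in \<mu>. norm (w x * u x) \<le> norm (u x)"
      using w1 by eventually_elim (simp add: abs_mult mult_left_le_one_le)
    have i: "integrable \<mu> (\<lambda>x. w x * u x)"
      using * iu by (intro Bochner_Integration.integrable_bound[OF iu]) auto
    have "(\<integral>x. w x * u x \<partial>\<mu>) \<le> (\<integral>x. \<bar>u x\<bar> \<partial>\<mu>)"
      using * i iu by (intro integral_mono_AE) auto
    also have "\<dots> = Lp_norm \<mu> q u" using 1 by (simp add: Lp_norm_def)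
    finally show ?thesis using i by simp
  next
    case (2 p p')
    have iw: "integrable \<mu> (\<lambda>x. \<bar>w x\<bar> powr p')" and iu: "integrable \<mu> (\<lambda>x. \<bar>u x\<bar> powr p)"
      using u w 2 by (simp_all add: Lp_space_def)
    have "(\<integral>x. \<bar>w x\<bar> powr p' \<partial>\<mu>) powr (1 / p') = 1"
      using w(3) 2 by (simp add: Lp_norm_def)
    then have "((\<integral>x. \<bar>w x\<bar> powr p' \<partial>\<mu>) powr (1 / p')) powr p' = 1" by simp
    then have Iw: "(\<integral>x. \<bar>w x\<bar> powr p' \<partial>\<mu>) = 1"
      using 2 by (simp add: powr_powr)
    define c where "c = Lp_norm \<mu> q u"
    have c: "c = (\<integral>x. \<bar>u x\<bar> powr p \<partial>\<mu>) powr (1 / p)" using 2 by (simp add: c_def Lp_norm_def)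
    have "c \<ge> 0" by (simp add: c)
    \<comment> \<open>Young's inequality with \<open>u\<close> divided by a free constant:
      \<open>b = 1\<close> yields integrability, and \<open>b = c\<close> yields the bound with
      constant one.\<close>
    have Y: "AE x in \<mu>. w x * (u x / b) \<le> \<bar>w x\<bar> powr p' / p' + \<bar>u x\<bar> powr p / (b powr p) / p" if "b > 0" for b
      using w(2) u(2)
    proof eventually_elim
      case (elim x)
      then have "w x * (u x / b) \<le> w x powr p' / p' + (u x / b) powr p / p"
        using 2 that by (intro Youngs_inequality) auto
      then show ?case using elim that by (simp add: powr_divide)
    qed
    have i: "integrable \<mu> (\<lambda>x. w x * u x)"
    proof (rule Bochner_Integration.integrable_bound)
      show "integrable \<mu> (\<lambda>x. \<bar>w x\<bar> powr p' / p' + \<bar>u x\<bar> powr p / p)"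
        using iu iw by simp
      show "AE x in \<mu>. norm (w x * u x) \<le> norm (\<bar>w x\<bar> powr p' / p' + \<bar>u x\<bar> powr p / p)"
        using Y[OF zero_less_one] w(2) u(2) by eventually_elim simp
    qed simp
    have "(\<integral>x. w x * u x \<partial>\<mu>) \<le> c"
    proof (cases "c = 0")
      case True
      then have "(\<integral>x. \<bar>u x\<bar> powr p \<partial>\<mu>) = 0" by (simp add: c)
      then have "AE x in \<mu>. \<bar>u x\<bar> powr p = 0"
        using iu by (subst (asm) integral_nonneg_eq_0_iff_AE) auto
      then have "AE x in \<mu>. w x * u x = 0" by eventually_elim simp
      then have "(\<integral>x. w x * u x \<partial>\<mu>) = 0" by (rule integral_eq_zero_AE)
      then show ?thesis using True by simp
    next
      case False
      then have c0: "c > 0" using \<open>c \<ge> 0\<close> by simp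
      have cp: "c powr p = (\<integral>x. \<bar>u x\<bar> powr p \<partial>\<mu>)"
        using 2 by (simp add: c powr_powr)
      have "(\<integral>x. w x * (u x / c) \<partial>\<mu>) \<le> (\<integral>x. \<bar>w x\<bar> powr p' / p' + \<bar>u x\<bar> powr p / (c powr p) / p \<partial>\<mu>)"
        using Y[OF c0] iu iw i by (intro integral_mono_AE) auto
      also have "\<dots> = 1 / p' + (c powr p) / (c powr p) / p"
        using iu iw by (simp add: Iw cp)
      also have "\<dots> = 1" using 2 c0 by simp
      finally have "(\<integral>x. w x * u x \<partial>\<mu>) / c \<le> 1" by simp
      then show ?thesis using c0 by (simp add: divide_le_eq)
    qed
    with i show ?thesis by (simp add: c_def)
  qed
  then show "integrable \<mu> (\<lambda>x. w x * u x)" "(\<integral>x. w x * u x \<partial>\<mu>) \<le> Lp_norm \<mu> q u" by auto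
qed

section \<open>The key estimate\<close>

lemma normed_latticeD:
  assumes "normed_lattice V N"
  shows "subspace V" "\<And>f g. f \<in> V \<Longrightarrow> g \<in> V \<Longrightarrow> sup f g \<in> V" "\<And>f g. f \<in> V \<Longrightarrow> g \<in> V \<Longrightarrow> inf f g \<in> V"
    "\<And>f. f \<in> V \<Longrightarrow> \<bar>f\<bar> \<in> V" "\<And>f. f \<in> V \<Longrightarrow> 0 \<le> N f" "N 0 = 0"
    "\<And>f c. f \<in> V \<Longrightarrow> N (c *\<^sub>R f) = \<bar>c\<bar> * N f"
    "\<And>f g. f \<in> V \<Longrightarrow> g \<in> V \<Longrightarrow> N (f + g) \<le> N f + N g"
    "\<And>f g. f \<in> V \<Longrightarrow> g \<in> V \<Longrightarrow> \<bar>f\<bar> \<le> \<bar>g\<bar> \<Longrightarrow> N f \<le> N g"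
    "\<And>f. f \<in> V \<Longrightarrow> N \<bar>f\<bar> = N f"
proof -
  note c = assms[unfolded normed_lattice_def]
  note n = c[THEN conjunct1] c[THEN conjunct2, THEN conjunct1]
    c[THEN conjunct2, THEN conjunct2, THEN conjunct1]
    c[THEN conjunct2, THEN conjunct2, THEN conjunct2, THEN conjunct1]
    c[THEN conjunct2, THEN conjunct2, THEN conjunct2, THEN conjunct2, THEN conjunct1]
    c[THEN conjunct2, THEN conjunct2, THEN conjunct2, THEN conjunct2, THEN conjunct2]
  show V: "subspace V" and s: "\<And>f g. f \<in> V \<Longrightarrow> g \<in> V \<Longrightarrow> sup f g \<in> V"
    and "\<And>f g. f \<in> V \<Longrightarrow> g \<in> V \<Longrightarrow> inf f g \<in> V"
    and "\<And>f. f \<in> V \<Longrightarrow> 0 \<le> N f" "\<And>f c. f \<in> V \<Longrightarrow> N (c *\<^sub>R f) = \<bar>c\<bar> * N f"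
    and "\<And>f g. f \<in> V \<Longrightarrow> g \<in> V \<Longrightarrow> N (f + g) \<le> N f + N g"
    and m: "\<And>f g. f \<in> V \<Longrightarrow> g \<in> V \<Longrightarrow> \<bar>f\<bar> \<le> \<bar>g\<bar> \<Longrightarrow> N f \<le> N g"
    using n by simp_all
  show a: "\<bar>f\<bar> \<in> V" if "f \<in> V" for f
    unfolding abs_lattice using that s V by (simp add: subspace_neg)
  show "N 0 = 0" using n(3) subspace_0[OF V] by simp
  show "N \<bar>f\<bar> = N f" if "f \<in> V" for f
    using m[OF a[OF that] that] m[OF that a[OF that]] by simp
qed

text \<open>Hoelder's inequality is taken as already applied: the exponents are gone, and what
  remains of the bound on \<open>T\<close> and of the norm of the weight is a weighted integral
  bound with the constant \<open>A\<close>.\<close>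

locale weighted_structure = sigma_finite_measure \<mu>
  for \<mu> :: "'a measure" +
  fixes Y :: "'d::finite \<Rightarrow> 'y::{ordered_real_vector, lattice_ab_group_add_abs} set"
    and N :: "'d \<Rightarrow> 'y \<Rightarrow> real"
    and T :: "('d \<Rightarrow> 'y) \<Rightarrow> 'a \<Rightarrow> real"
    and w :: "'a \<Rightarrow> real" and A B :: real
  assumes lattice: "\<And>j. normed_lattice (Y j) (N j)"
    and multilinear: "positive_multilinear_op \<mu> Y T"
    and A_nonneg: "0 \<le> A" and B_nonneg: "0 \<le> B"
    and structural: "structural_hypothesis \<mu> Y N T B"
    and weight_nonneg: "AE x in \<mu>. 0 \<le> w x"
    and integrable_weighted: "\<And>f. f \<in> nonneg_tuples Y \<Longrightarrow> integrable \<mu> (\<lambda>x. w x * root CARD('d) (T f x))"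
    and integral_weighted_le: "\<And>f. f \<in> nonneg_tuples Y \<Longrightarrow>
      (\<integral>x. w x * root CARD('d) (T f x) \<partial>\<mu>) \<le> A * root CARD('d) (\<Prod>j\<in>UNIV. N j (f j))"
begin

definition \<Phi> :: "('d \<Rightarrow> 'y) \<Rightarrow> 'a set \<Rightarrow> real" where
  "\<Phi> f E = (\<integral>x\<in>E. w x * root CARD('d) (T f x) \<partial>\<mu>)"

lemmas Y_subspace = normed_latticeD(1)[OF lattice]
lemmas Y_sup = normed_latticeD(2)[OF lattice]
lemmas Y_inf = normed_latticeD(3)[OF lattice]
lemmas Y_abs = normed_latticeD(4)[OF lattice]
lemmas N_nonneg = normed_latticeD(5)[OF lattice]
lemmas N_zero = normed_latticeD(6)[OF lattice]
lemmas N_scale = normed_latticeD(7)[OF lattice]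
lemmas N_add = normed_latticeD(8)[OF lattice]
lemmas N_mono = normed_latticeD(9)[OF lattice]
lemmas N_abs = normed_latticeD(10)[OF lattice]
lemmas Y_zero = subspace_0[OF Y_subspace]
lemmas Y_add = subspace_add[OF Y_subspace]
lemmas Y_diff = subspace_diff[OF Y_subspace]
lemmas Y_scale = subspace_scale[OF Y_subspace]
lemmas Y_sum = subspace_sum[OF Y_subspace]

lemma N_mono_nonneg: "f \<in> Y j \<Longrightarrow> g \<in> Y j \<Longrightarrow> 0 \<le> f \<Longrightarrow> f \<le> g \<Longrightarrow> N j f \<le> N j g"
  by (rule N_mono) (auto simp: abs_of_nonneg)

lemma nonneg_tuplesI: "(\<And>j. f j \<in> Y j) \<Longrightarrow> (\<And>j. 0 \<le> f j) \<Longrightarrow> f \<in> nonneg_tuples Y"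
  by (simp add: nonneg_tuples_def)

lemma nonneg_tuplesD: "f \<in> nonneg_tuples Y \<Longrightarrow> f j \<in> Y j" "f \<in> nonneg_tuples Y \<Longrightarrow> 0 \<le> f j"
  by (auto simp: nonneg_tuples_def)

lemma T_nonneg: "f \<in> nonneg_tuples Y \<Longrightarrow> AE x in \<mu>. 0 \<le> T f x"
  using multilinear by (simp add: positive_multilinear_op_def)

lemma T_add:
  assumes "f \<in> nonneg_tuples Y" "g \<in> Y j"
  shows "AE x in \<mu>. T (f(j := f j + g)) x = T f x + T (f(j := g)) x"
  using multilinear assms unfolding positive_multilinear_op_def nonneg_tuples_def by blast

lemma integrable_indicator_weighted:
  assumes "f \<in> nonneg_tuples Y" "E \<in> sets \<mu>"
  shows "integrable \<mu> (\<lambda>x. indicator E x *\<^sub>R (w x * root CARD('d) (T f x)))"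
  using integrable_weighted[OF assms(1)] assms(2) by (rule integrable_mult_indicator[rotated])

lemma weighted_nonneg:
  assumes "f \<in> nonneg_tuples Y"
  shows "AE x in \<mu>. 0 \<le> w x * root CARD('d) (T f x)"
  using weight_nonneg T_nonneg[OF assms] by eventually_elim simp

lemma \<Phi>_le:
  assumes f: "f \<in> nonneg_tuples Y" and E: "E \<in> sets \<mu>"
  shows "\<Phi> f E \<le> A * root CARD('d) (\<Prod>j\<in>UNIV. N j (f j))"
proof -
  have "\<Phi> f E \<le> (\<integral>x. w x * root CARD('d) (T f x) \<partial>\<mu>)"
    unfolding \<Phi>_def set_lebesgue_integral_def
    using weighted_nonneg[OF f]
    by (intro integral_mono_AE integrable_indicator_weighted integrable_weighted f E)
      (auto simp: indicator_def)
  also note integral_weighted_le[OF f]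
  finally show ?thesis .
qed

text \<open>The coordinates of \<open>h\<close> are exchanged for those of \<open>u\<close> one at a
  time. By multilinearity and subadditivity of the root, each exchange costs \<open>\<Phi>\<close>
  at a tuple with \<open>v j\<close> in slot j and entries no larger in norm than those of
  \<open>h\<close> elsewhere, and \<open>\<Phi>_le\<close> bounds that cost. A \<open>v\<close> of
  small norm thus causes a small error, uniformly in \<open>E\<close>.\<close>

lemma \<Phi>_perturb:
  assumes u: "u \<in> nonneg_tuples Y" and v: "v \<in> nonneg_tuples Y" and h: "h = (\<lambda>j. u j + v j)"
    and E: "E \<in> sets \<mu>"
  shows "\<Phi> h E \<le> \<Phi> u E + (\<Sum>j\<in>UNIV. A * root CARD('d) (N j (v j) * (\<Prod>k\<in>UNIV - {j}. N k (h k))))"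
proof -
  define m where "m J k = (if k \<in> J then u k else h k)" for J k
  have hN: "h \<in> nonneg_tuples Y"
    unfolding h using nonneg_tuplesD[OF u] nonneg_tuplesD[OF v]
    by (intro nonneg_tuplesI Y_add add_nonneg_nonneg)
  have mN: "m J \<in> nonneg_tuples Y" for J
    by (intro nonneg_tuplesI) (simp_all add: m_def nonneg_tuplesD[OF u] nonneg_tuplesD[OF hN])
  have mh: "N k (m J k) \<le> N k (h k)" for J k
  proof (cases "k \<in> J")
    case True
    have "N k (u k) \<le> N k (h k)"
      using nonneg_tuplesD[OF u, of k] nonneg_tuplesD[OF hN, of k] nonneg_tuplesD[OF v, of k]
      by (intro N_mono_nonneg) (simp_all add: h)
    with True show ?thesis by (simp add: m_def)
  qed (simp add: m_def)
  have "\<Phi> h E \<le> \<Phi> (m J) E + (\<Sum>j\<in>J. A * root CARD('d) (N j (v j) * (\<Prod>k\<in>UNIV - {j}. N k (h k))))"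
    if "finite J" for J
    using that
  proof (induction J rule: finite_induct)
    case empty
    have "m {} = h" by (auto simp: m_def)
    then show ?case by simp
  next
    case (insert j J)
    define f where "f = m (insert j J)"
    define g where "g = f(j := v j)"
    have f: "f \<in> nonneg_tuples Y" by (simp add: f_def mN)
    have g: "g \<in> nonneg_tuples Y"
      unfolding g_def using nonneg_tuplesD[OF f] nonneg_tuplesD[OF v] by (intro nonneg_tuplesI) auto
    have mJ: "m J = f(j := f j + v j)"
      using insert.hyps by (auto simp: f_def m_def h)
    have "AE x in \<mu>. w x * root CARD('d) (T (m J) x) \<le> w x * root CARD('d) (T f x) + w x * root CARD('d) (T g x)"
      using T_add[OF f nonneg_tuplesD(1)[OF v], of j] T_nonneg[OF f] T_nonneg[OF g] weight_nonneg
    proof eventually_elim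
      case (elim x)
      then have "root CARD('d) (T (m J) x) \<le> root CARD('d) (T f x) + root CARD('d) (T g x)"
        by (simp add: mJ g_def root_add_le)
      then have "w x * root CARD('d) (T (m J) x) \<le> w x * (root CARD('d) (T f x) + root CARD('d) (T g x))"
        using elim by (intro mult_left_mono) auto
      then show ?case by (simp add: distrib_left)
    qed
    then have "\<Phi> (m J) E \<le> (\<integral>x. indicator E x *\<^sub>R (w x * root CARD('d) (T f x)) + indicator E x *\<^sub>R (w x * root CARD('d) (T g x)) \<partial>\<mu>)"
      unfolding \<Phi>_def set_lebesgue_integral_def
      by (intro integral_mono_AE integrable_indicator_weighted Bochner_Integration.integrable_add mN f g E)
        (auto simp: indicator_def)
    also have "\<dots> = \<Phi> f E + \<Phi> g E"
      unfolding \<Phi>_def set_lebesgue_integral_def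
      by (intro Bochner_Integration.integral_add integrable_indicator_weighted f g E)
    also have "\<Phi> g E \<le> A * root CARD('d) (\<Prod>k\<in>UNIV. N k (g k))" by (rule \<Phi>_le[OF g E])
    also have "(\<Prod>k\<in>UNIV. N k (g k)) = N j (v j) * (\<Prod>k\<in>UNIV - {j}. N k (f k))"
      by (subst prod.remove[of _ j]) (auto simp: g_def)
    also have "A * root CARD('d) \<dots> \<le> A * root CARD('d) (N j (v j) * (\<Prod>k\<in>UNIV - {j}. N k (h k)))"
      using mh[of _ "insert j J"] nonneg_tuplesD[OF v] nonneg_tuplesD[OF f] A_nonneg
      by (intro mult_left_mono iffD2[OF real_root_le_iff] prod_mono) (auto simp: f_def intro: N_nonneg)
    finally have "\<Phi> (m J) E \<le> \<Phi> f E + A * root CARD('d) (N j (v j) * (\<Prod>k\<in>UNIV - {j}. N k (h k)))" by simp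
    with insert show ?case by (simp add: f_def)
  qed
  from this[of UNIV] have "\<Phi> h E \<le> \<Phi> (m UNIV) E + (\<Sum>j\<in>UNIV. A * root CARD('d) (N j (v j) * (\<Prod>k\<in>UNIV - {j}. N k (h k))))"
    by simp
  moreover have "m UNIV = u" by (auto simp: m_def)
  ultimately show ?thesis by simp
qed

text \<open>One family \<open>S\<close>, chosen for \<open>g\<close>, dominates \<open>T\<close> at
  every \<open>h i\<close>. After Hoelder's inequality for sums, linearity moves the sum over i
  inside \<open>S j\<close>, and positivity at the difference between \<open>g j\<close> and that
  sum replaces it by \<open>g j\<close>, where the product is controlled by
  \<open>T g\<close>.\<close>

lemma sum_root_T_le:
  assumes S: "\<And>j. positive_linear_op \<mu> (Y j) (S j)"
    and dom: "\<And>h. h \<in> nonneg_tuples Y \<Longrightarrow> AE x in \<mu>. T h x \<le> (\<Prod>j\<in>UNIV. S j (h j) x)"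
    and attain: "AE x in \<mu>. (\<Prod>j\<in>UNIV. S j (g j) x) \<le> B ^ CARD('d) * T g x"
    and g: "g \<in> nonneg_tuples Y"
    and I: "finite I" "\<And>i. i \<in> I \<Longrightarrow> h i \<in> nonneg_tuples Y" "\<And>j. (\<Sum>i\<in>I. h i j) \<le> g j"
  shows "AE x in \<mu>. (\<Sum>i\<in>I. root CARD('d) (T (h i) x)) \<le> B * root CARD('d) (T g x)"
proof -
  have Sadd: "AE x in \<mu>. S j (f + f') x = S j f x + S j f' x" if "f \<in> Y j" "f' \<in> Y j" for f f' j
    using S[of j] that unfolding positive_linear_op_def by blast
  have Spos: "AE x in \<mu>. 0 \<le> S j f x" if "f \<in> Y j" "0 \<le> f" for f j
    using S[of j] that unfolding positive_linear_op_def by blast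
  have "AE x in \<mu>. S j (0 *\<^sub>R 0) x = 0 * S j 0 x" for j
    using S[of j] Y_zero unfolding positive_linear_op_def by blast
  then have S0: "AE x in \<mu>. S j 0 x = 0" for j by simp
  have Ssum: "AE x in \<mu>. S j (\<Sum>i\<in>I. h i j) x = (\<Sum>i\<in>I. S j (h i j) x)" for j
    using I(1,2)
  proof (induction I rule: finite_induct)
    case (insert k I)
    have "AE x in \<mu>. S j (h k j + (\<Sum>i\<in>I. h i j)) x = S j (h k j) x + S j (\<Sum>i\<in>I. h i j) x"
      using nonneg_tuplesD(1)[OF insert.prems] by (intro Sadd Y_sum) auto
    moreover have "AE x in \<mu>. S j (\<Sum>i\<in>I. h i j) x = (\<Sum>i\<in>I. S j (h i j) x)"
      using insert by auto
    ultimately show ?case by eventually_elim (use insert.hyps in simp)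
  qed (use S0 in simp)
  have sumY: "(\<Sum>i\<in>I. h i j) \<in> Y j" for j using nonneg_tuplesD(1)[OF I(2)] by (intro Y_sum)
  have gsplit: "AE x in \<mu>. S j (g j) x = S j (\<Sum>i\<in>I. h i j) x + S j (g j - (\<Sum>i\<in>I. h i j)) x" for j
    using Sadd[OF sumY[of j] Y_diff[OF nonneg_tuplesD(1)[OF g] sumY[of j]]] by simp
  have gpos: "AE x in \<mu>. 0 \<le> S j (g j - (\<Sum>i\<in>I. h i j)) x" for j
    using I(3) Y_diff[OF nonneg_tuplesD(1)[OF g] sumY[of j]] by (intro Spos) simp_all
  have Sle: "AE x in \<mu>. \<forall>j. (\<Sum>i\<in>I. S j (h i j) x) \<le> S j (g j) x"
    unfolding AE_all_countable
  proof
    fix j show "AE x in \<mu>. (\<Sum>i\<in>I. S j (h i j) x) \<le> S j (g j) x"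
      using gsplit[of j] gpos[of j] Ssum[of j] by eventually_elim simp
  qed
  have "AE x in \<mu>. \<forall>i\<in>I. T (h i) x \<le> (\<Prod>j\<in>UNIV. S j (h i j) x)"
    using I by (intro AE_finite_allI dom) auto
  moreover have "AE x in \<mu>. \<forall>i\<in>I. \<forall>j. 0 \<le> S j (h i j) x"
    using I(1) nonneg_tuplesD[OF I(2)] by (intro AE_finite_allI) (auto simp: AE_all_countable intro!: Spos)
  ultimately show ?thesis using Sle attain T_nonneg[OF g]
  proof eventually_elim
    case (elim x)
    have "(\<Sum>i\<in>I. root CARD('d) (T (h i) x)) \<le> (\<Sum>i\<in>I. root CARD('d) (\<Prod>j\<in>UNIV. S j (h i j) x))"
      using elim by (intro sum_mono) simp
    also have "\<dots> \<le> root CARD('d) (\<Prod>j\<in>UNIV. \<Sum>i\<in>I. S j (h i j) x)"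
      using elim I(1) by (intro sum_root_prod_le) auto
    also have "\<dots> \<le> root CARD('d) (\<Prod>j\<in>UNIV. S j (g j) x)"
      using elim by (auto intro!: prod_mono sum_nonneg)
    also have "\<dots> \<le> root CARD('d) (B ^ CARD('d) * T g x)" using elim by simp
    also have "\<dots> = B * root CARD('d) (T g x)"
      using B_nonneg by (simp add: real_root_mult real_root_power_cancel)
    finally show ?case .
  qed
qed

text \<open>At a point x only the indices with \<open>x \<in> E i\<close> count. They form one of
  finitely many subsets of \<open>K\<close>, so a single null set serves the pointwise estimate for
  all of them. Whether a subset sum lies below \<open>g\<close> does not depend on x, and for almost
  every x the subset that occurs has this property.\<close>

lemma sum_\<Phi>_le_attained:
  assumes S: "\<And>j. positive_linear_op \<mu> (Y j) (S j)"
      "\<And>h. h \<in> nonneg_tuples Y \<Longrightarrow> AE x in \<mu>. T h x \<le> (\<Prod>j\<in>UNIV. S j (h j) x)"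
      "AE x in \<mu>. (\<Prod>j\<in>UNIV. S j (g j) x) \<le> B ^ CARD('d) * T g x"
    and g: "g \<in> nonneg_tuples Y"
    and K: "finite K" "\<And>i. i \<in> K \<Longrightarrow> h i \<in> nonneg_tuples Y" "\<And>i. i \<in> K \<Longrightarrow> E i \<in> sets \<mu>"
    and le: "AE x in \<mu>. \<forall>j. (\<Sum>i\<in>K. if x \<in> E i then h i j else 0) \<le> g j"
  shows "real CARD('d) * (\<Sum>i\<in>K. \<Phi> (h i) (E i)) \<le> A * B * (\<Sum>j\<in>UNIV. N j (g j))"
proof -
  have "AE x in \<mu>. \<forall>I\<in>Pow K. (\<forall>j. (\<Sum>i\<in>I. h i j) \<le> g j) \<longrightarrow>
      (\<Sum>i\<in>I. root CARD('d) (T (h i) x)) \<le> B * root CARD('d) (T g x)"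
  proof (rule AE_finite_allI)
    fix I assume I: "I \<in> Pow K"
    then have "finite I" using K(1) finite_subset by blast
    show "AE x in \<mu>. (\<forall>j. (\<Sum>i\<in>I. h i j) \<le> g j) \<longrightarrow>
        (\<Sum>i\<in>I. root CARD('d) (T (h i) x)) \<le> B * root CARD('d) (T g x)"
    proof (cases "\<forall>j. (\<Sum>i\<in>I. h i j) \<le> g j")
      case True
      with sum_root_T_le[OF S g \<open>finite I\<close>, of h] K(2) I show ?thesis by auto
    next
      case False
      show ?thesis by (rule AE_I2) (use False in blast)
    qed
  qed (use K in simp)
  then have "AE x in \<mu>. (\<Sum>i\<in>K. indicator (E i) x *\<^sub>R (w x * root CARD('d) (T (h i) x))) \<le> B * (w x * root CARD('d) (T g x))"
    using le weight_nonneg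
  proof eventually_elim
    case (elim x)
    define I where "I = {i\<in>K. x \<in> E i}"
    have "(\<Sum>i\<in>I. h i j) \<le> g j" for j
      using elim(2) K(1) by (simp add: I_def sum.If_cases Int_def)
    with elim(1) have "(\<Sum>i\<in>I. root CARD('d) (T (h i) x)) \<le> B * root CARD('d) (T g x)" by (auto simp: I_def)
    with elim(3) have "w x * (\<Sum>i\<in>I. root CARD('d) (T (h i) x)) \<le> w x * (B * root CARD('d) (T g x))"
      by (intro mult_left_mono)
    also have "w x * (\<Sum>i\<in>I. root CARD('d) (T (h i) x)) = (\<Sum>i\<in>K. if x \<in> E i then w x * root CARD('d) (T (h i) x) else 0)"
      using K(1) by (simp add: I_def sum.If_cases Int_def sum_distrib_left)
    also have "(\<Sum>i\<in>K. if x \<in> E i then w x * root CARD('d) (T (h i) x) else 0)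
        = (\<Sum>i\<in>K. indicator (E i) x *\<^sub>R (w x * root CARD('d) (T (h i) x)))"
      by (intro sum.cong) auto
    finally show ?case by (simp add: mult_ac)
  qed
  then have "(\<integral>x. (\<Sum>i\<in>K. indicator (E i) x *\<^sub>R (w x * root CARD('d) (T (h i) x))) \<partial>\<mu>) \<le> (\<integral>x. B * (w x * root CARD('d) (T g x)) \<partial>\<mu>)"
    using K by (intro integral_mono_AE Bochner_Integration.integrable_sum integrable_indicator_weighted
        integrable_mult_right integrable_weighted g) auto
  also have "\<dots> = B * (\<integral>x. w x * root CARD('d) (T g x) \<partial>\<mu>)" by simp
  also have "\<dots> \<le> B * (A * root CARD('d) (\<Prod>j\<in>UNIV. N j (g j)))"
    by (intro mult_left_mono integral_weighted_le g B_nonneg)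
  finally have "(\<Sum>i\<in>K. \<Phi> (h i) (E i)) \<le> B * A * root CARD('d) (\<Prod>j\<in>UNIV. N j (g j))"
    unfolding \<Phi>_def set_lebesgue_integral_def
    using K by (subst (asm) Bochner_Integration.integral_sum) (auto simp del: real_scaleR_def intro: integrable_indicator_weighted)
  then have "real CARD('d) * (\<Sum>i\<in>K. \<Phi> (h i) (E i)) \<le> real CARD('d) * (B * A * root CARD('d) (\<Prod>j\<in>UNIV. N j (g j)))"
    by (intro mult_left_mono) auto
  also have "\<dots> = A * B * (real CARD('d) * root CARD('d) (\<Prod>j\<in>UNIV. N j (g j)))" by (simp add: mult_ac)
  also have "\<dots> \<le> A * B * (\<Sum>j\<in>UNIV. N j (g j))"
    using A_nonneg B_nonneg nonneg_tuplesD[OF g]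
    by (intro mult_left_mono root_prod_le_mean N_nonneg) auto
  finally show ?thesis .
qed

text \<open>
  If \<open>g'\<close> approximates \<open>g\<close> and \<open>e = \<bar>g - g'\<bar>\<close>, then the truncations \<open>(h - e)\<^sup>+\<close> fit below \<open>g'\<close>
  whenever the \<open>h\<close> fit below \<open>g\<close>, and what is cut off, \<open>inf h e\<close>, is small in norm.
\<close>

lemma sum_\<Phi>_le:
  assumes g: "g \<in> nonneg_tuples Y"
    and K: "finite K" "\<And>i. i \<in> K \<Longrightarrow> h i \<in> nonneg_tuples Y" "\<And>i. i \<in> K \<Longrightarrow> E i \<in> sets \<mu>"
    and le: "AE x in \<mu>. \<forall>j. (\<Sum>i\<in>K. if x \<in> E i then h i j else 0) \<le> g j"
  shows "real CARD('d) * (\<Sum>i\<in>K. \<Phi> (h i) (E i)) \<le> A * B * (\<Sum>j\<in>UNIV. N j (g j))"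
proof -
  obtain D where dense: "dense_in_tuples N (D \<inter> nonneg_tuples Y) (nonneg_tuples Y)"
    and SD: "\<And>f. f \<in> D \<inter> nonneg_tuples Y \<Longrightarrow> \<exists>S.
          (\<forall>j. positive_linear_op \<mu> (Y j) (S j)) \<and>
          (\<forall>h\<in>nonneg_tuples Y. AE x in \<mu>. T h x \<le> (\<Prod>j\<in>UNIV. S j (h j) x)) \<and>
          (AE x in \<mu>. (\<Prod>j\<in>UNIV. S j (f j) x) \<le> B ^ CARD('d) * T f x)"
    using structural unfolding structural_hypothesis_def by blast
  define C where "C i j = (\<Prod>k\<in>UNIV - {j}. N k (h i k))" for i j
  have C: "C i j \<ge> 0" if "i \<in> K" for i j
    unfolding C_def using nonneg_tuplesD(1)[OF K(2)[OF that]] by (intro prod_nonneg) (auto intro: N_nonneg)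
  \<comment> \<open>The bound at precision \<open>\<epsilon>\<close>: the norms of the approximating
    tuple exceed those of \<open>g\<close> by at most \<open>\<epsilon>\<close>, and each truncation
    costs the error of \<open>\<Phi>_perturb\<close>. As \<open>C i j\<close> does not depend on the
    approximating tuple, letting \<open>\<epsilon>\<close> tend to 0 removes both.\<close>
  define rhs where "rhs \<epsilon> = A * B * (\<Sum>j\<in>UNIV. N j (g j) + \<epsilon>) +
      real CARD('d) * (\<Sum>i\<in>K. \<Sum>j\<in>UNIV. A * root CARD('d) (\<epsilon> * C i j))" for \<epsilon>
  have step: "real CARD('d) * (\<Sum>i\<in>K. \<Phi> (h i) (E i)) \<le> rhs \<epsilon>" if \<epsilon>: "\<epsilon> > 0" for \<epsilon>
  proof -
    from dense g \<epsilon> obtain g' where g': "g' \<in> D \<inter> nonneg_tuples Y" "\<And>j. N j (g j - g' j) < \<epsilon>"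
      unfolding dense_in_tuples_def by blast
    have g'N: "g' \<in> nonneg_tuples Y" using g' by simp
    define e where "e j = \<bar>g j - g' j\<bar>" for j
    have eY: "e j \<in> Y j" and e0: "0 \<le> e j" and eN: "N j (e j) < \<epsilon>" for j
      using Y_diff[OF nonneg_tuplesD(1)[OF g] nonneg_tuplesD(1)[OF g'N], of j] g'(2)[of j]
      by (simp_all add: e_def Y_abs N_abs)
    have ge: "g j \<le> g' j + e j" for j
      using abs_ge_self[of "g j - g' j"] by (simp add: e_def algebra_simps)
    define u where "u i j = sup (h i j - e j) 0" for i j
    define v where "v i j = inf (h i j) (e j)" for i j
    have huv: "h i = (\<lambda>j. u i j + v i j)" for i
    proof
      fix j
      have "u i j = h i j + sup (- e j) (- h i j)"
        unfolding u_def add_sup_distrib_left by simp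
      also have "sup (- e j) (- h i j) = - v i j"
        by (simp add: v_def neg_inf_eq_sup sup_commute)
      finally show "h i j = u i j + v i j" by simp
    qed
    have u: "u i \<in> nonneg_tuples Y" if "i \<in> K" for i
      unfolding u_def using nonneg_tuplesD(1)[OF K(2)[OF that]] eY
      by (intro nonneg_tuplesI) (auto intro: Y_sup Y_diff Y_zero)
    have v: "v i \<in> nonneg_tuples Y" if "i \<in> K" for i
      unfolding v_def using nonneg_tuplesD[OF K(2)[OF that]] eY e0
      by (intro nonneg_tuplesI) (auto intro: Y_inf)
    have Nv: "N j (v i j) \<le> \<epsilon>" if "i \<in> K" for i j
    proof -
      have "N j (v i j) \<le> N j (e j)"
        using nonneg_tuplesD[OF v[OF that], of j] eY by (intro N_mono_nonneg) (auto simp: v_def)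
      with eN[of j] show ?thesis by simp
    qed
    have "AE x in \<mu>. \<forall>j. (\<Sum>i\<in>K. if x \<in> E i then u i j else 0) \<le> g' j"
      using le
    proof eventually_elim
      case (elim x)
      show ?case
      proof
        fix j
        have "(\<Sum>i\<in>{i\<in>K. x \<in> E i}. h i j) \<le> g' j + e j"
          using elim K(1) order_trans[OF _ ge[of j]] by (simp add: sum.If_cases Int_def)
        then have "(\<Sum>i\<in>{i\<in>K. x \<in> E i}. u i j) \<le> g' j"
          unfolding u_def using K(1) e0 nonneg_tuplesD(2)[OF g'N] nonneg_tuplesD(2)[OF K(2)]
          by (intro sum_truncated_le) auto
        then show "(\<Sum>i\<in>K. if x \<in> E i then u i j else 0) \<le> g' j"
          using K(1) by (simp add: sum.If_cases Int_def)
      qed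
    qed
    moreover obtain S where "\<And>j. positive_linear_op \<mu> (Y j) (S j)"
      "\<And>h. h \<in> nonneg_tuples Y \<Longrightarrow> AE x in \<mu>. T h x \<le> (\<Prod>j\<in>UNIV. S j (h j) x)"
      "AE x in \<mu>. (\<Prod>j\<in>UNIV. S j (g' j) x) \<le> B ^ CARD('d) * T g' x"
      using SD[OF g'(1)] by blast
    ultimately have u_le: "real CARD('d) * (\<Sum>i\<in>K. \<Phi> (u i) (E i)) \<le> A * B * (\<Sum>j\<in>UNIV. N j (g' j))"
      using g'N K u by (intro sum_\<Phi>_le_attained) auto
    have "\<Phi> (h i) (E i) \<le> \<Phi> (u i) (E i) + (\<Sum>j\<in>UNIV. A * root CARD('d) (\<epsilon> * C i j))" if "i \<in> K" for i
    proof -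
      have "\<Phi> (h i) (E i) \<le> \<Phi> (u i) (E i) + (\<Sum>j\<in>UNIV. A * root CARD('d) (N j (v i j) * C i j))"
        unfolding C_def using u v K(3) huv that by (intro \<Phi>_perturb) auto
      also have "(\<Sum>j\<in>UNIV. A * root CARD('d) (N j (v i j) * C i j)) \<le> (\<Sum>j\<in>UNIV. A * root CARD('d) (\<epsilon> * C i j))"
        using Nv[OF that] C[OF that] A_nonneg
        by (intro sum_mono mult_left_mono iffD2[OF real_root_le_iff] mult_right_mono) auto
      finally show ?thesis by simp
    qed
    then have "(\<Sum>i\<in>K. \<Phi> (h i) (E i)) \<le> (\<Sum>i\<in>K. \<Phi> (u i) (E i)) + (\<Sum>i\<in>K. \<Sum>j\<in>UNIV. A * root CARD('d) (\<epsilon> * C i j))"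
      unfolding sum.distrib[symmetric] by (rule sum_mono)
    then have "real CARD('d) * (\<Sum>i\<in>K. \<Phi> (h i) (E i)) \<le>
        real CARD('d) * ((\<Sum>i\<in>K. \<Phi> (u i) (E i)) + (\<Sum>i\<in>K. \<Sum>j\<in>UNIV. A * root CARD('d) (\<epsilon> * C i j)))"
      by (intro mult_left_mono) auto
    also have "\<dots> \<le> A * B * (\<Sum>j\<in>UNIV. N j (g' j)) + real CARD('d) * (\<Sum>i\<in>K. \<Sum>j\<in>UNIV. A * root CARD('d) (\<epsilon> * C i j))"
      using u_le by (simp add: distrib_left)
    also have "A * B * (\<Sum>j\<in>UNIV. N j (g' j)) \<le> A * B * (\<Sum>j\<in>UNIV. N j (g j) + \<epsilon>)"
    proof (intro mult_left_mono sum_mono mult_nonneg_nonneg A_nonneg B_nonneg)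
      fix j
      have gd: "g j - g' j \<in> Y j" by (rule Y_diff[OF nonneg_tuplesD(1)[OF g] nonneg_tuplesD(1)[OF g'N]])
      have "N j (g' j) = N j (g j + (-1) *\<^sub>R (g j - g' j))" by simp
      also have "\<dots> \<le> N j (g j) + N j ((-1) *\<^sub>R (g j - g' j))"
        using nonneg_tuplesD(1)[OF g] Y_scale[OF gd] by (rule N_add)
      also have "N j ((-1) *\<^sub>R (g j - g' j)) = N j (g j - g' j)"
        using N_scale[OF gd, of "-1"] by simp
      finally show "N j (g' j) \<le> N j (g j) + \<epsilon>" using g'(2)[of j] by simp
    qed
    finally show ?thesis by (simp add: rhs_def)
  qed
  have "(rhs \<longlongrightarrow> A * B * (\<Sum>j\<in>UNIV. N j (g j) + 0) + real CARD('d) * (\<Sum>i\<in>K. \<Sum>j\<in>UNIV. A * root CARD('d) (0 * C i j))) (at_right 0)"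
    unfolding rhs_def by (intro tendsto_intros)
  then have "(rhs \<longlongrightarrow> A * B * (\<Sum>j\<in>UNIV. N j (g j))) (at_right 0)" by simp
  moreover have "eventually (\<lambda>\<epsilon>. real CARD('d) * (\<Sum>i\<in>K. \<Phi> (h i) (E i)) \<le> rhs \<epsilon>) (at_right 0)"
    using eventually_at_right_less[of "0::real"] by eventually_elim (rule step)
  ultimately show ?thesis by (rule tendsto_lowerbound) simp
qed

end

section \<open>Finitely additive operators from the Hahn--Banach theorem\<close>

text \<open>Applied twice, this makes the functions from X to tuples a real vector space, the
  ambient space of the Hahn-Banach functional.\<close>

instantiation "fun" :: (type, real_vector) real_vector
begin

definition scaleR_fun :: "real \<Rightarrow> ('a \<Rightarrow> 'b) \<Rightarrow> 'a \<Rightarrow> 'b" where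
  "scaleR_fun c f = (\<lambda>x. c *\<^sub>R f x)"

instance
  by standard (simp_all add: scaleR_fun_def fun_eq_iff scaleR_add_right scaleR_add_left)

end

lemma sum_fun_apply: "(\<Sum>i\<in>I. f i) x = (\<Sum>i\<in>I. f i x)"
  for f :: "'i \<Rightarrow> 'x \<Rightarrow> 'b::comm_monoid_add"
  by (induction I rule: infinite_finite_induct) simp_all

context weighted_structure
begin

lemma T_scale:
  assumes f: "f \<in> nonneg_tuples Y" and a: "\<And>j. 0 \<le> a j"
  shows "AE x in \<mu>. T (\<lambda>j. a j *\<^sub>R f j) x = (\<Prod>j\<in>UNIV. a j) * T f x"
proof -
  define m where "m J = (\<lambda>j. if j \<in> J then a j *\<^sub>R f j else f j)" for J
  have mY: "m J \<in> tuples Y" for J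
    using nonneg_tuplesD(1)[OF f] by (simp add: m_def Y_scale)
  have "AE x in \<mu>. T (m J) x = (\<Prod>j\<in>J. a j) * T f x" if "finite J" for J
    using that
  proof (induction J rule: finite_induct)
    case empty
    have "m {} = f" by (auto simp: m_def)
    then show ?case by simp
  next
    case (insert k J)
    have "m (insert k J) = (m J)(k := a k *\<^sub>R m J k)"
      using insert.hyps by (auto simp: m_def)
    then have "AE x in \<mu>. T (m (insert k J)) x = a k * T (m J) x"
      using multilinear mY[of J] by (auto simp: positive_multilinear_op_def)
    with insert.IH show ?case
      by eventually_elim (use insert.hyps in simp)
  qed
  from this[of UNIV] show ?thesis by (simp add: m_def)
qed

lemma scale_nonneg_tuples:
  "f \<in> nonneg_tuples Y \<Longrightarrow> (\<And>j. 0 \<le> a j) \<Longrightarrow> (\<lambda>j. a j *\<^sub>R f j) \<in> nonneg_tuples Y"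
  by (intro nonneg_tuplesI) (simp_all add: nonneg_tuplesD Y_scale scaleR_nonneg_nonneg)

text \<open>The d-th root turns homogeneity of degree d into degree 1, which is what closes the set
  of constraints under scaling.\<close>

lemma \<Phi>_scale:
  assumes f: "f \<in> nonneg_tuples Y" and c: "0 \<le> c" and E: "E \<in> sets \<mu>"
  shows "\<Phi> (\<lambda>j. c *\<^sub>R f j) E = c * \<Phi> f E"
proof -
  have cf: "(\<lambda>j. c *\<^sub>R f j) \<in> nonneg_tuples Y" using scale_nonneg_tuples[OF f, of "\<lambda>_. c"] c by simp
  have *: "AE x in \<mu>. indicator E x *\<^sub>R (w x * root CARD('d) (T (\<lambda>j. c *\<^sub>R f j) x))
      = c * (indicator E x *\<^sub>R (w x * root CARD('d) (T f x)))"
    using T_scale[OF f, of "\<lambda>_. c"] c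
    by (auto simp: real_root_mult real_root_power_cancel elim!: eventually_mono)
  have "\<Phi> (\<lambda>j. c *\<^sub>R f j) E = (\<integral>x. c * (indicator E x *\<^sub>R (w x * root CARD('d) (T f x))) \<partial>\<mu>)"
    unfolding \<Phi>_def set_lebesgue_integral_def
    using * integrable_indicator_weighted[OF cf E] integrable_indicator_weighted[OF f E]
    by (intro integral_cong_AE) auto
  then show ?thesis by (simp add: \<Phi>_def set_lebesgue_integral_def)
qed

text \<open>Lists allow a pair to be counted several times, and their concatenation realises the
  addition of constraints.\<close>

lemma sum_list_\<Phi>_le:
  assumes g: "g \<in> nonneg_tuples Y" and xs: "set xs \<subseteq> nonneg_tuples Y \<times> sets \<mu>"
    and le: "AE x in \<mu>. \<forall>j. (\<Sum>p\<leftarrow>xs. if x \<in> snd p then fst p j else 0) \<le> g j"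
  shows "real CARD('d) * (\<Sum>p\<leftarrow>xs. \<Phi> (fst p) (snd p)) \<le> A * B * (\<Sum>j\<in>UNIV. N j (g j))"
proof -
  have "xs ! i \<in> nonneg_tuples Y \<times> sets \<mu>" if "i < length xs" for i
    using xs that by (auto dest: nth_mem)
  then have "fst (xs ! i) \<in> nonneg_tuples Y" "snd (xs ! i) \<in> sets \<mu>" if "i < length xs" for i
    using that by (auto simp: mem_Times_iff)
  then have "real CARD('d) * (\<Sum>i\<in>{0..<length xs}. \<Phi> (fst (xs ! i)) (snd (xs ! i)))
      \<le> A * B * (\<Sum>j\<in>UNIV. N j (g j))"
    using le by (intro sum_\<Phi>_le[OF g]) (auto simp: sum_list_sum_nth)
  then show ?thesis by (simp add: sum_list_sum_nth)
qed

text \<open>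
  A member \<open>(F, r)\<close> of the cone encodes the constraint that the sought functional \<open>L\<close>, which
  should satisfy \<open>L (h on E) \<ge> d \<Phi> h E\<close> and \<open>L g \<le> A B \<Sum>\<^sub>j N j (g j)\<close>, must satisfy \<open>L F \<le> r\<close>.
\<close>

definition constraints :: "(('a \<Rightarrow> 'd \<Rightarrow> 'y) \<times> real) set" where
  "constraints = {(F, r). \<exists>xs g. set xs \<subseteq> nonneg_tuples Y \<times> sets \<mu> \<and> g \<in> nonneg_tuples Y \<and>
    (AE x in \<mu>. \<forall>j. F x j + (\<Sum>p\<leftarrow>xs. if x \<in> snd p then fst p j else 0) \<le> g j) \<and>
    A * B * (\<Sum>j\<in>UNIV. N j (g j)) - real CARD('d) * (\<Sum>p\<leftarrow>xs. \<Phi> (fst p) (snd p)) \<le> r}"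

lemma constraintsI:
  assumes "set xs \<subseteq> nonneg_tuples Y \<times> sets \<mu>" "g \<in> nonneg_tuples Y"
    "AE x in \<mu>. \<forall>j. F x j + (\<Sum>p\<leftarrow>xs. if x \<in> snd p then fst p j else 0) \<le> g j"
    "A * B * (\<Sum>j\<in>UNIV. N j (g j)) - real CARD('d) * (\<Sum>p\<leftarrow>xs. \<Phi> (fst p) (snd p)) \<le> r"
  shows "(F, r) \<in> constraints"
  using assms unfolding constraints_def by blast

lemma zero_nonneg_tuples: "(\<lambda>_. 0) \<in> nonneg_tuples Y"
  by (intro nonneg_tuplesI) (auto simp: Y_zero)

text \<open>Consistency is the key estimate: for \<open>F = 0\<close> the side condition becomes
  that of \<open>sum_list_\<Phi>_le\<close>, whose conclusion says that the admissible values are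
  nonnegative. Closure under addition uses the triangle inequality for the norms, closure under
  scaling the homogeneity of \<open>\<Phi>\<close>.\<close>

lemma consistent_cone_constraints: "consistent_cone constraints"
  unfolding consistent_cone_def
proof (intro conjI ballI allI impI)
  fix a b assume "a \<in> constraints" "b \<in> constraints"
  then obtain F r G s xs ys g h where ab: "a = (F, r)" "b = (G, s)"
    and xs: "set xs \<subseteq> nonneg_tuples Y \<times> sets \<mu>" and ys: "set ys \<subseteq> nonneg_tuples Y \<times> sets \<mu>"
    and g: "g \<in> nonneg_tuples Y" and h: "h \<in> nonneg_tuples Y"
    and F: "AE x in \<mu>. \<forall>j. F x j + (\<Sum>p\<leftarrow>xs. if x \<in> snd p then fst p j else 0) \<le> g j"
    and G: "AE x in \<mu>. \<forall>j. G x j + (\<Sum>p\<leftarrow>ys. if x \<in> snd p then fst p j else 0) \<le> h j"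
    and r: "A * B * (\<Sum>j\<in>UNIV. N j (g j)) - real CARD('d) * (\<Sum>p\<leftarrow>xs. \<Phi> (fst p) (snd p)) \<le> r"
    and s: "A * B * (\<Sum>j\<in>UNIV. N j (h j)) - real CARD('d) * (\<Sum>p\<leftarrow>ys. \<Phi> (fst p) (snd p)) \<le> s"
    unfolding constraints_def by (auto simp del: split_paired_Ex)
  have "(F + G, r + s) \<in> constraints"
  proof (rule constraintsI[of "xs @ ys" "\<lambda>j. g j + h j"])
    show "set (xs @ ys) \<subseteq> nonneg_tuples Y \<times> sets \<mu>" using xs ys by simp
    show "(\<lambda>j. g j + h j) \<in> nonneg_tuples Y"
      using nonneg_tuplesD[OF g] nonneg_tuplesD[OF h] by (intro nonneg_tuplesI Y_add add_nonneg_nonneg)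
    show "AE x in \<mu>. \<forall>j. (F + G) x j + (\<Sum>p\<leftarrow>xs @ ys. if x \<in> snd p then fst p j else 0) \<le> g j + h j"
      using F G
    proof eventually_elim
      case (elim x)
      show ?case
      proof
        fix j
        from add_mono[OF spec[OF elim(1), of j] spec[OF elim(2), of j]]
        show "(F + G) x j + (\<Sum>p\<leftarrow>xs @ ys. if x \<in> snd p then fst p j else 0) \<le> g j + h j"
          by (simp add: ac_simps)
      qed
    qed
    have "(\<Sum>j\<in>UNIV. N j (g j + h j)) \<le> (\<Sum>j\<in>UNIV. N j (g j) + N j (h j))"
      using nonneg_tuplesD[OF g] nonneg_tuplesD[OF h] by (intro sum_mono N_add)
    then have "A * B * (\<Sum>j\<in>UNIV. N j (g j + h j)) \<le> A * B * (\<Sum>j\<in>UNIV. N j (g j) + N j (h j))"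
      using A_nonneg B_nonneg by (intro mult_left_mono) auto
    then show "A * B * (\<Sum>j\<in>UNIV. N j (g j + h j)) - real CARD('d) * (\<Sum>p\<leftarrow>xs @ ys. \<Phi> (fst p) (snd p)) \<le> r + s"
      using r s by (simp add: sum.distrib distrib_left)
  qed
  then show "a + b \<in> constraints" by (simp add: ab)
next
  fix a and c :: real assume "a \<in> constraints" and c: "0 < c"
  then obtain F r xs g where a: "a = (F, r)"
    and xs: "set xs \<subseteq> nonneg_tuples Y \<times> sets \<mu>" and g: "g \<in> nonneg_tuples Y"
    and F: "AE x in \<mu>. \<forall>j. F x j + (\<Sum>p\<leftarrow>xs. if x \<in> snd p then fst p j else 0) \<le> g j"
    and r: "A * B * (\<Sum>j\<in>UNIV. N j (g j)) - real CARD('d) * (\<Sum>p\<leftarrow>xs. \<Phi> (fst p) (snd p)) \<le> r"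
    unfolding constraints_def by (auto simp del: split_paired_Ex)
  define sc where "sc p = ((\<lambda>j. c *\<^sub>R fst p j), snd p)" for p :: "('d \<Rightarrow> 'y) \<times> 'a set"
  have xsD: "fst p \<in> nonneg_tuples Y" "snd p \<in> sets \<mu>" if "p \<in> set xs" for p
    using subsetD[OF xs that] by (simp_all add: mem_Times_iff)
  have "(c *\<^sub>R F, c * r) \<in> constraints"
  proof (rule constraintsI[of "map sc xs" "\<lambda>j. c *\<^sub>R g j"])
    show "set (map sc xs) \<subseteq> nonneg_tuples Y \<times> sets \<mu>"
      using xsD c scale_nonneg_tuples[of _ "\<lambda>_. c"] by (auto simp: sc_def)
    show "(\<lambda>j. c *\<^sub>R g j) \<in> nonneg_tuples Y"
      using scale_nonneg_tuples[OF g, of "\<lambda>_. c"] c by simp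
    show "AE x in \<mu>. \<forall>j. (c *\<^sub>R F) x j + (\<Sum>p\<leftarrow>map sc xs. if x \<in> snd p then fst p j else 0) \<le> c *\<^sub>R g j"
      using F
    proof eventually_elim
      case (elim x)
      have *: "c *\<^sub>R (\<Sum>p\<leftarrow>zs. if x \<in> snd p then fst p j else 0)
          = (\<Sum>p\<leftarrow>map sc zs. if x \<in> snd p then fst p j else 0)" for zs j
        by (induction zs) (simp_all add: sc_def scaleR_add_right)
      show ?case
      proof
        fix j
        have "c *\<^sub>R (F x j + (\<Sum>p\<leftarrow>xs. if x \<in> snd p then fst p j else 0)) \<le> c *\<^sub>R g j"
          using elim c by (intro scaleR_left_mono) auto
        then show "(c *\<^sub>R F) x j + (\<Sum>p\<leftarrow>map sc xs. if x \<in> snd p then fst p j else 0) \<le> c *\<^sub>R g j"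
          unfolding scaleR_add_right * by (simp add: scaleR_fun_def)
      qed
    qed
    have "(\<Sum>p\<leftarrow>map sc xs. \<Phi> (fst p) (snd p)) = (\<Sum>p\<leftarrow>xs. c * \<Phi> (fst p) (snd p))"
      unfolding map_map comp_def
      by (intro arg_cong[where f=sum_list] map_cong refl) (use xsD c in \<open>simp add: sc_def \<Phi>_scale\<close>)
    also have "\<dots> = c * (\<Sum>p\<leftarrow>xs. \<Phi> (fst p) (snd p))" by (simp add: sum_list_const_mult)
    finally have 1: "(\<Sum>p\<leftarrow>map sc xs. \<Phi> (fst p) (snd p)) = c * (\<Sum>p\<leftarrow>xs. \<Phi> (fst p) (snd p))" .
    have 2: "(\<Sum>j\<in>UNIV. N j (c *\<^sub>R g j)) = c * (\<Sum>j\<in>UNIV. N j (g j))"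
      using nonneg_tuplesD[OF g] c by (simp add: N_scale sum_distrib_left)
    show "A * B * (\<Sum>j\<in>UNIV. N j (c *\<^sub>R g j)) - real CARD('d) * (\<Sum>p\<leftarrow>map sc xs. \<Phi> (fst p) (snd p)) \<le> c * r"
      using mult_left_mono[OF r, of c] c unfolding 1 2 by (simp add: algebra_simps)
  qed
  then show "c *\<^sub>R a \<in> constraints" by (simp add: a)
next
  fix r assume "(0, r) \<in> constraints"
  then obtain xs g where xs: "set xs \<subseteq> nonneg_tuples Y \<times> sets \<mu>" and g: "g \<in> nonneg_tuples Y"
    and F: "AE x in \<mu>. \<forall>j. (\<Sum>p\<leftarrow>xs. if x \<in> snd p then fst p j else 0) \<le> g j"
    and r: "A * B * (\<Sum>j\<in>UNIV. N j (g j)) - real CARD('d) * (\<Sum>p\<leftarrow>xs. \<Phi> (fst p) (snd p)) \<le> r"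
    unfolding constraints_def by (auto simp del: split_paired_Ex)
  from sum_list_\<Phi>_le[OF g xs F] r show "0 \<le> r" by simp
qed

text \<open>The charge \<open>\<rho> j h E\<close> is the value of the functional at the function
  that equals \<open>h\<close> in coordinate j on \<open>E\<close> and 0 elsewhere. Linearity of the
  functional gives linearity in \<open>h\<close> and additivity in \<open>E\<close>; each inequality
  comes from one explicit member of the cone.\<close>

lemma exists_charges:
  obtains \<rho> :: "'d \<Rightarrow> 'y \<Rightarrow> 'a set \<Rightarrow> real" where
    "\<And>j h. h \<in> Y j \<Longrightarrow> 0 \<le> h \<Longrightarrow> ac_charge \<mu> (\<rho> j h)"
    "\<And>j h. h \<in> Y j \<Longrightarrow> 0 \<le> h \<Longrightarrow> \<rho> j h (space \<mu>) \<le> A * B * N j h"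
    "\<And>j g h. g \<in> Y j \<Longrightarrow> 0 \<le> g \<Longrightarrow> h \<in> Y j \<Longrightarrow> 0 \<le> h \<Longrightarrow> \<rho> j (g + h) = (\<lambda>E. \<rho> j g E + \<rho> j h E)"
    "\<And>j h c. h \<in> Y j \<Longrightarrow> 0 \<le> h \<Longrightarrow> \<rho> j (c *\<^sub>R h) = (\<lambda>E. c * \<rho> j h E)"
    "\<And>h E. h \<in> nonneg_tuples Y \<Longrightarrow> E \<in> sets \<mu> \<Longrightarrow> real CARD('d) * \<Phi> h E \<le> (\<Sum>j\<in>UNIV. \<rho> j (h j) E)"
proof -
  \<comment> \<open>Functions bounded on both sides, almost everywhere, by one nonnegative tuple.
    The symmetry makes \<open>V\<close> a subspace, and the tuple is the witness that every member
    has an admissible value.\<close>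
  define V where "V = {F :: 'a \<Rightarrow> 'd \<Rightarrow> 'y. \<exists>g\<in>nonneg_tuples Y. AE x in \<mu>. \<forall>j. F x j \<le> g j \<and> - F x j \<le> g j}"
  have VI: "F \<in> V" if "g \<in> nonneg_tuples Y" "AE x in \<mu>. \<forall>j. F x j \<le> g j \<and> - F x j \<le> g j" for F g
    using that unfolding V_def by blast
  have "subspace V"
  proof (rule subspaceI)
    show "0 \<in> V" by (rule VI[OF zero_nonneg_tuples]) simp
    fix F G assume "F \<in> V" "G \<in> V"
    then obtain g h where g: "g \<in> nonneg_tuples Y" "AE x in \<mu>. \<forall>j. F x j \<le> g j \<and> - F x j \<le> g j"
      and h: "h \<in> nonneg_tuples Y" "AE x in \<mu>. \<forall>j. G x j \<le> h j \<and> - G x j \<le> h j"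
      unfolding V_def by blast
    show "F + G \<in> V"
    proof (rule VI)
      show "(\<lambda>j. g j + h j) \<in> nonneg_tuples Y"
        using nonneg_tuplesD[OF g(1)] nonneg_tuplesD[OF h(1)]
        by (intro nonneg_tuplesI Y_add add_nonneg_nonneg)
      show "AE x in \<mu>. \<forall>j. (F + G) x j \<le> g j + h j \<and> - (F + G) x j \<le> g j + h j"
        using g(2) h(2)
      proof eventually_elim
        case (elim x)
        show ?case
        proof
          fix j
          have "F x j + G x j \<le> g j + h j" "- F x j + - G x j \<le> g j + h j"
            using elim by (intro add_mono; simp)+
          then show "(F + G) x j \<le> g j + h j \<and> - (F + G) x j \<le> g j + h j" by simp
        qed
      qed
    qed
  next
    fix F and c :: real assume "F \<in> V"
    then obtain g where g: "g \<in> nonneg_tuples Y" "AE x in \<mu>. \<forall>j. F x j \<le> g j \<and> - F x j \<le> g j"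
      unfolding V_def by blast
    show "c *\<^sub>R F \<in> V"
    proof (rule VI)
      show "(\<lambda>j. \<bar>c\<bar> *\<^sub>R g j) \<in> nonneg_tuples Y"
        using scale_nonneg_tuples[OF g(1), of "\<lambda>_. \<bar>c\<bar>"] by simp
      show "AE x in \<mu>. \<forall>j. (c *\<^sub>R F) x j \<le> \<bar>c\<bar> *\<^sub>R g j \<and> - (c *\<^sub>R F) x j \<le> \<bar>c\<bar> *\<^sub>R g j"
        using g(2)
      proof eventually_elim
        case (elim x)
        show ?case
        proof
          fix j
          have "\<bar>c\<bar> *\<^sub>R F x j \<le> \<bar>c\<bar> *\<^sub>R g j" "\<bar>c\<bar> *\<^sub>R (- F x j) \<le> \<bar>c\<bar> *\<^sub>R g j"
            using elim by (intro scaleR_left_mono; simp)+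
          then show "(c *\<^sub>R F) x j \<le> \<bar>c\<bar> *\<^sub>R g j \<and> - (c *\<^sub>R F) x j \<le> \<bar>c\<bar> *\<^sub>R g j"
            by (cases "0 \<le> c") (simp_all add: scaleR_fun_def)
        qed
      qed
    qed
  qed
  have dom: "\<exists>r. (F, r) \<in> constraints" if "F \<in> V" for F
  proof -
    from that obtain g where g: "g \<in> nonneg_tuples Y" "AE x in \<mu>. \<forall>j. F x j \<le> g j \<and> - F x j \<le> g j"
      unfolding V_def by blast
    have "AE x in \<mu>. \<forall>j. F x j \<le> g j" using g(2) by eventually_elim simp
    then have "(F, A * B * (\<Sum>j\<in>UNIV. N j (g j))) \<in> constraints"
      by (intro constraintsI[of "[]" g] g) simp_all
    then show ?thesis by blast
  qed
  have "(0, 0) \<in> constraints"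
    by (rule constraintsI[of "[]", OF _ zero_nonneg_tuples]) (simp_all add: N_zero)
  from Hahn_Banach_cone[OF consistent_cone_constraints this \<open>subspace V\<close> dom] obtain L where
    L_le: "\<And>F r. F \<in> V \<Longrightarrow> (F, r) \<in> constraints \<Longrightarrow> L F \<le> r"
    and L_add: "\<And>F G. F \<in> V \<Longrightarrow> G \<in> V \<Longrightarrow> L (F + G) = L F + L G"
    and L_scale: "\<And>F c. F \<in> V \<Longrightarrow> L (c *\<^sub>R F) = c * L F"
    by metis
  have L_neg: "L (- F) = - L F" if "F \<in> V" for F
    using L_scale[OF that, of "-1"] by simp
  have V_neg: "- F \<in> V" if "F \<in> V" for F
    using \<open>subspace V\<close> that by (rule subspace_neg)
  have L_zero: "L 0 = 0" using L_scale[OF subspace_0[OF \<open>subspace V\<close>], of 0] by simp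
  have L_sum: "L (\<Sum>j\<in>J. F j) = (\<Sum>j\<in>J. L (F j))" if "finite J" "\<And>j. j \<in> J \<Longrightarrow> F j \<in> V" for F and J :: "'d set"
    using that
  proof (induction J rule: finite_induct)
    case (insert k J)
    then have "(\<Sum>j\<in>J. F j) \<in> V" "F k \<in> V" using \<open>subspace V\<close> by (auto intro: subspace_sum)
    with insert show ?case by (simp add: L_add del: plus_fun_apply)
  qed (simp add: L_zero)
  define single where "single j h E = (\<lambda>x k. if x \<in> E \<and> k = j then h else 0)"
    for j :: 'd and h :: 'y and E :: "'a set"
  define \<rho> where "\<rho> j h E = L (single j h E)" for j h E
  have coord: "(\<lambda>k. if k = j then h else 0) \<in> nonneg_tuples Y" if "h \<in> Y j" "0 \<le> h" for j h
    using that by (intro nonneg_tuplesI) (auto simp: Y_zero)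
  have V_single: "single j h E \<in> V" if h: "h \<in> Y j" "0 \<le> h" for j h E
    using h minus_le_self_iff[of h]
    by (intro VI[OF coord[OF h]] AE_I2) (auto simp: single_def)
  have nonneg: "0 \<le> \<rho> j h E" if h: "h \<in> Y j" "0 \<le> h" for j h E
  proof -
    \<comment> \<open>With the empty list and the zero tuple, a constraint says that the functional
      is at most 0 on functions that are at most 0.\<close>
    have "(- single j h E, 0) \<in> constraints"
      using h by (intro constraintsI[of "[]", OF _ zero_nonneg_tuples]) (auto simp: N_zero single_def)
    from L_le[OF V_neg[OF V_single[OF h]] this] show ?thesis
      using L_neg[OF V_single[OF h]] by (simp add: \<rho>_def)
  qed
  have null: "\<rho> j h E = 0" if h: "h \<in> Y j" "0 \<le> h" and E: "E \<in> null_sets \<mu>" for j h E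
  proof -
    have "AE x in \<mu>. \<forall>k. single j h E x k \<le> 0"
      using AE_not_in[OF E] by eventually_elim (simp add: single_def)
    then have "(single j h E, 0) \<in> constraints"
      by (intro constraintsI[of "[]", OF _ zero_nonneg_tuples]) (auto simp: N_zero)
    from L_le[OF V_single[OF h] this] nonneg[OF h, of E] show ?thesis by (simp add: \<rho>_def)
  qed
  have union: "\<rho> j h (E \<union> F) = \<rho> j h E + \<rho> j h F" if h: "h \<in> Y j" "0 \<le> h" and "E \<inter> F = {}" for j h E F
  proof -
    have "single j h (E \<union> F) = single j h E + single j h F"
      using that(3) by (intro ext) (auto simp: single_def)
    then show ?thesis using L_add[OF V_single[OF h] V_single[OF h]] by (simp add: \<rho>_def)
  qed
  show thesis
  proof (rule that[of \<rho>])
    fix j h assume h: "h \<in> Y j" "0 \<le> h"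
    show "ac_charge \<mu> (\<rho> j h)" using nonneg[OF h] null[OF h] union[OF h] by (simp add: ac_charge_def)
    have N1: "(\<Sum>k\<in>UNIV. N k (if k = j then h else 0)) = N j h"
      by (subst sum.remove[of _ j]) (auto simp: N_zero intro!: sum.neutral)
    \<comment> \<open>The bounding tuple has \<open>h\<close> in coordinate j and 0 elsewhere, so
      that only \<open>N j h\<close> is left of the sum of norms.\<close>
    have "(single j h (space \<mu>), A * B * N j h) \<in> constraints"
      using h by (intro constraintsI[of "[]", OF _ coord[OF h]] AE_I2) (auto simp: N1 single_def)
    from L_le[OF V_single[OF h] this] show "\<rho> j h (space \<mu>) \<le> A * B * N j h" by (simp add: \<rho>_def)
    show "\<rho> j (c *\<^sub>R h) = (\<lambda>E. c * \<rho> j h E)" for c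
    proof
      fix E
      have "single j (c *\<^sub>R h) E = c *\<^sub>R single j h E"
        by (intro ext) (simp add: single_def scaleR_fun_def)
      then show "\<rho> j (c *\<^sub>R h) E = c * \<rho> j h E" using L_scale[OF V_single[OF h]] by (simp add: \<rho>_def)
    qed
    fix g assume g: "g \<in> Y j" "0 \<le> g"
    show "\<rho> j (g + h) = (\<lambda>E. \<rho> j g E + \<rho> j h E)"
    proof
      fix E
      have "single j (g + h) E = single j g E + single j h E"
        by (intro ext) (simp add: single_def)
      then show "\<rho> j (g + h) E = \<rho> j g E + \<rho> j h E"
        using L_add[OF V_single[OF g] V_single[OF h]] by (simp add: \<rho>_def)
    qed
  next
    fix h E assume h: "h \<in> nonneg_tuples Y" and E: "E \<in> sets \<mu>"
    define F where "F = (\<Sum>j\<in>UNIV. single j (h j) E)"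
    have Fx: "F x k = (if x \<in> E then h k else 0)" for x k
      unfolding F_def sum_fun_apply single_def by simp
    have FV: "F \<in> V"
      unfolding F_def using \<open>subspace V\<close> V_single nonneg_tuplesD[OF h] by (intro subspace_sum) auto
    \<comment> \<open>The one-element list cancels \<open>- F\<close> exactly, so the zero tuple
      bounds what remains, and the admissible value is the desired lower bound with its sign
      reversed.\<close>
    have "(- F, - (real CARD('d) * \<Phi> h E)) \<in> constraints"
      using h E by (intro constraintsI[of "[(h, E)]", OF _ zero_nonneg_tuples]) (auto simp: N_zero Fx)
    from L_le[OF V_neg[OF FV] this] have "real CARD('d) * \<Phi> h E \<le> L F"
      using L_neg[OF FV] by simp
    also have "L F = (\<Sum>j\<in>UNIV. \<rho> j (h j) E)"
      unfolding F_def \<rho>_def using V_single nonneg_tuplesD[OF h] by (intro L_sum) auto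
    finally show "real CARD('d) * \<Phi> h E \<le> (\<Sum>j\<in>UNIV. \<rho> j (h j) E)" .
  qed
qed

end

section \<open>The factorisation\<close>

context weighted_structure
begin

text \<open>Charges are available for nonnegative elements only, so the densities are taken there
  and extended to differences. The multiplicative inequality is recovered pointwise from the
  additive one, applied to all rescalings of the tuple by positive rational weights.\<close>

lemma exists_factorisation:
  "\<exists>R. (\<forall>j. positive_linear_op \<mu> (Y j) (R j)) \<and>
    (\<forall>j. \<forall>f\<in>Y j. integrable \<mu> (R j f) \<and> (\<integral>x. \<bar>R j f x\<bar> \<partial>\<mu>) \<le> A * B * N j f) \<and>
    (\<forall>f\<in>nonneg_tuples Y. AE x in \<mu>. w x ^ CARD('d) * T f x \<le> (\<Prod>j\<in>UNIV. R j (f j) x))"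
proof (rule exists_charges)
  fix \<rho> :: "'d \<Rightarrow> 'y \<Rightarrow> 'a set \<Rightarrow> real"
  assume charge: "\<And>j h. h \<in> Y j \<Longrightarrow> 0 \<le> h \<Longrightarrow> ac_charge \<mu> (\<rho> j h)"
    and bound: "\<And>j h. h \<in> Y j \<Longrightarrow> 0 \<le> h \<Longrightarrow> \<rho> j h (space \<mu>) \<le> A * B * N j h"
    and add: "\<And>j g h. g \<in> Y j \<Longrightarrow> 0 \<le> g \<Longrightarrow> h \<in> Y j \<Longrightarrow> 0 \<le> h \<Longrightarrow> \<rho> j (g + h) = (\<lambda>E. \<rho> j g E + \<rho> j h E)"
    and scale: "\<And>j h c. h \<in> Y j \<Longrightarrow> 0 \<le> h \<Longrightarrow> \<rho> j (c *\<^sub>R h) = (\<lambda>E. c * \<rho> j h E)"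
    and \<Phi>_le_sum: "\<And>h E. h \<in> nonneg_tuples Y \<Longrightarrow> E \<in> sets \<mu> \<Longrightarrow> real CARD('d) * \<Phi> h E \<le> (\<Sum>j\<in>UNIV. \<rho> j (h j) E)"
  define r where "r j h = ac_density \<mu> (\<rho> j h)" for j h
  have r_int: "integrable \<mu> (r j h)" and r_le: "(\<integral>x. r j h x \<partial>\<mu>) \<le> A * B * N j h" and r_nonneg: "0 \<le> r j h x"
    if "h \<in> Y j" "0 \<le> h" for j h x
    using integrable_ac_density[OF charge[OF that]] bound[OF that] ac_density_nonneg[OF charge[OF that]]
    by (simp_all add: r_def)
  have r_add: "AE x in \<mu>. r j (g + h) x = r j g x + r j h x"
    if "g \<in> Y j" "0 \<le> g" "h \<in> Y j" "0 \<le> h" for j g h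
    unfolding r_def add[OF that] by (intro ac_density_add charge that)
  have r_scale: "AE x in \<mu>. r j (c *\<^sub>R h) x = c * r j h x" if "h \<in> Y j" "0 \<le> h" "0 < c" for j h c
    unfolding r_def scale[OF that(1,2)] by (intro ac_density_cmult charge that)
  have r_zero: "AE x in \<mu>. r j 0 x = 0" for j
    using r_add[of 0 j 0] by (simp add: Y_zero)
  define R where "R j f x = r j (sup f 0) x - r j (sup (- f) 0) x" for j f x
  have pos: "sup f 0 \<in> Y j" "0 \<le> sup f 0" "sup (- f) 0 \<in> Y j" "0 \<le> sup (- f) 0" if "f \<in> Y j" for f j
    using that by (auto intro!: Y_sup Y_zero subspace_neg[OF Y_subspace])
  have diff: "f = sup f 0 - sup (- f) 0" for f :: 'y
    using prts[of f] nprt_def[of f] neg_inf_eq_sup[of f 0]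
    by (simp add: pprt_def)
  \<comment> \<open>\<open>R j\<close> may be computed from any representation as a difference of
    nonnegative elements: moving the subtracted parts to the other side gives an equality of sums,
    on which \<open>r j\<close> is additive. Additivity and homogeneity of \<open>R j\<close> reduce
    to this.\<close>
  have R_diff: "AE x in \<mu>. R j (a - b) x = r j a x - r j b x"
    if ab: "a \<in> Y j" "0 \<le> a" "b \<in> Y j" "0 \<le> b" for j a b
  proof -
    let ?f = "a - b"
    have fY: "?f \<in> Y j" using ab by (intro Y_diff)
    note p = pos[OF fY]
    have "u + y = v + x" if "x - y = u - v" for u v x y :: 'y
    proof -
      have "u + y = (u - v) + (v + y)" by (simp add: algebra_simps)
      also have "\<dots> = (x - y) + (v + y)" by (simp only: that)
      also have "\<dots> = v + x" by (simp add: algebra_simps)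
      finally show ?thesis .
    qed
    from this[OF diff[of ?f]] have "sup ?f 0 + b = sup (- ?f) 0 + a" .
    with r_add[OF p(1,2) ab(3,4)]
    have "AE x in \<mu>. r j (sup (- ?f) 0 + a) x = r j (sup ?f 0) x + r j b x" by simp
    with r_add[OF p(3,4) ab(1,2)] show ?thesis
      by eventually_elim (simp add: R_def)
  qed
  have R_nonneg: "AE x in \<mu>. R j f x = r j f x" if "f \<in> Y j" "0 \<le> f" for j f
  proof -
    have "AE x in \<mu>. R j (f - 0) x = r j f x - r j 0 x" by (rule R_diff[OF that Y_zero order_refl])
    with r_zero[of j] show ?thesis by eventually_elim simp
  qed
  have R_op: "positive_linear_op \<mu> (Y j) (R j)" for j
    unfolding positive_linear_op_def
  proof (intro conjI ballI allI impI)
    fix f assume f: "f \<in> Y j"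
    note pf = pos[OF f]
    note [measurable] = borel_measurable_integrable[OF r_int[OF pf(1,2)]]
      borel_measurable_integrable[OF r_int[OF pf(3,4)]]
    show "R j f \<in> borel_measurable \<mu>" unfolding R_def by measurable
    show "AE x in \<mu>. 0 \<le> R j f x" if "0 \<le> f"
      using R_nonneg[OF f that] r_nonneg[OF f that] by (auto elim: eventually_mono)
    show "AE x in \<mu>. R j (f + g) x = R j f x + R j g x" if g: "g \<in> Y j" for g
    proof -
      note pg = pos[OF g]
      have "f + g = (sup f 0 - sup (- f) 0) + (sup g 0 - sup (- g) 0)"
        by (simp only: diff[symmetric])
      also have "\<dots> = (sup f 0 + sup g 0) - (sup (- f) 0 + sup (- g) 0)"
        by (rule add_diff_add[symmetric])
      finally have "AE x in \<mu>. R j (f + g) x = r j (sup f 0 + sup g 0) x - r j (sup (- f) 0 + sup (- g) 0) x"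
        using R_diff[of "sup f 0 + sup g 0" j "sup (- f) 0 + sup (- g) 0"] pf pg
        by (simp add: Y_add add_nonneg_nonneg)
      with r_add[OF pf(1,2) pg(1,2)] r_add[OF pf(3,4) pg(3,4)] show ?thesis
        by eventually_elim (simp add: R_def)
    qed
    show "AE x in \<mu>. R j (c *\<^sub>R f) x = c * R j f x" for c
    proof (cases c "0::real" rule: linorder_cases)
      case less
      have "c *\<^sub>R (u - v) = (- c) *\<^sub>R v - (- c) *\<^sub>R u" for u v :: 'y
        by (simp add: scaleR_diff_right)
      from this[of "sup f 0" "sup (- f) 0"]
      have "c *\<^sub>R f = (- c) *\<^sub>R sup (- f) 0 - (- c) *\<^sub>R sup f 0"
        by (simp only: diff[symmetric])
      then have "AE x in \<mu>. R j (c *\<^sub>R f) x = r j ((- c) *\<^sub>R sup (- f) 0) x - r j ((- c) *\<^sub>R sup f 0) x"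
        using R_diff[of "(- c) *\<^sub>R sup (- f) 0" j "(- c) *\<^sub>R sup f 0"] pf less
        by (simp only: Y_scale scaleR_nonneg_nonneg neg_0_le_iff_le less_imp_le)
      moreover have "0 < - c" using less by simp
      note r_scale[OF pf(1,2) this] r_scale[OF pf(3,4) this]
      ultimately show ?thesis by eventually_elim (simp add: R_def algebra_simps)
    next
      case equal
      then show ?thesis using R_diff[OF Y_zero order_refl Y_zero order_refl] by simp
    next
      case greater
      have "c *\<^sub>R f = c *\<^sub>R sup f 0 - c *\<^sub>R sup (- f) 0"
        by (simp only: scaleR_diff_right[symmetric] diff[symmetric])
      then have "AE x in \<mu>. R j (c *\<^sub>R f) x = r j (c *\<^sub>R sup f 0) x - r j (c *\<^sub>R sup (- f) 0) x"
        using R_diff[of "c *\<^sub>R sup f 0" j "c *\<^sub>R sup (- f) 0"] pf greater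
        by (simp only: Y_scale scaleR_nonneg_nonneg less_imp_le)
      with r_scale[OF pf(1,2) greater] r_scale[OF pf(3,4) greater] show ?thesis
        by eventually_elim (simp add: R_def algebra_simps)
    qed
  qed
  have R_int: "integrable \<mu> (R j f)" and R_le: "(\<integral>x. \<bar>R j f x\<bar> \<partial>\<mu>) \<le> A * B * N j f" if f: "f \<in> Y j" for j f
  proof -
    note pf = pos[OF f]
    show i: "integrable \<mu> (R j f)" unfolding R_def using r_int pf by (intro Bochner_Integration.integrable_diff)
    have abs: "sup f 0 + sup (- f) 0 = \<bar>f\<bar>"
      using abs_prts[of f] nprt_def[of f] neg_inf_eq_sup[of f 0] by (simp add: pprt_def)
    have aY: "\<bar>f\<bar> \<in> Y j" "0 \<le> \<bar>f\<bar>" using Y_abs[OF f] by simp_all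
    \<comment> \<open>Passing through \<open>\<bar>f\<bar>\<close>, which has the same norm as
      \<open>f\<close>, avoids the factor 2 that separate estimates of the two parts would
      cost.\<close>
    have "AE x in \<mu>. \<bar>R j f x\<bar> \<le> r j \<bar>f\<bar> x"
      using r_add[OF pf, unfolded abs]
      by eventually_elim (use r_nonneg[OF pf(1,2)] r_nonneg[OF pf(3,4)] in \<open>auto simp: R_def abs_le_iff\<close>)
    then have "(\<integral>x. \<bar>R j f x\<bar> \<partial>\<mu>) \<le> (\<integral>x. r j \<bar>f\<bar> x \<partial>\<mu>)"
      using i r_int[OF aY] by (intro integral_mono_AE) auto
    also have "\<dots> \<le> A * B * N j f" using r_le[OF aY] f by (simp add: N_abs)
    finally show "(\<integral>x. \<bar>R j f x\<bar> \<partial>\<mu>) \<le> A * B * N j f" .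
  qed
  \<comment> \<open>The lower bound is known for the sum of the charges, not for any one of them. It
    passes to the density of the sum, which then splits into the sum of the densities.\<close>
  have mean: "AE x in \<mu>. real CARD('d) * (w x * root CARD('d) (T f x)) \<le> (\<Sum>j\<in>UNIV. r j (f j) x)"
    if f: "f \<in> nonneg_tuples Y" for f
  proof -
    have ch: "ac_charge \<mu> (\<rho> j (f j))" for j using nonneg_tuplesD[OF f] by (rule charge)
    have "AE x in \<mu>. real CARD('d) * (w x * root CARD('d) (T f x)) \<le> ac_density \<mu> (\<lambda>E. \<Sum>j\<in>UNIV. \<rho> j (f j) E) x"
    proof (rule le_ac_density)
      show "ac_charge \<mu> (\<lambda>E. \<Sum>j\<in>UNIV. \<rho> j (f j) E)" using ch by (intro ac_charge_sum) auto
      show "integrable \<mu> (\<lambda>x. real CARD('d) * (w x * root CARD('d) (T f x)))"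
        using integrable_weighted[OF f] by (rule integrable_mult_right)
      show "AE x in \<mu>. 0 \<le> real CARD('d) * (w x * root CARD('d) (T f x))"
        using weighted_nonneg[OF f] by eventually_elim simp
      fix E assume E: "E \<in> sets \<mu>"
      have "(\<integral>x\<in>E. real CARD('d) * (w x * root CARD('d) (T f x)) \<partial>\<mu>) = real CARD('d) * \<Phi> f E"
        unfolding \<Phi>_def by (rule set_integral_mult_right)
      then show "(\<integral>x\<in>E. real CARD('d) * (w x * root CARD('d) (T f x)) \<partial>\<mu>) \<le> (\<Sum>j\<in>UNIV. \<rho> j (f j) E)"
        using \<Phi>_le_sum[OF f E] by simp
    qed
    moreover have "AE x in \<mu>. ac_density \<mu> (\<lambda>E. \<Sum>j\<in>UNIV. \<rho> j (f j) E) x = (\<Sum>j\<in>UNIV. r j (f j) x)"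
      unfolding r_def using ch by (intro ac_density_sum) auto
    ultimately show ?thesis by eventually_elim simp
  qed
  have "AE x in \<mu>. w x ^ CARD('d) * T f x \<le> (\<Prod>j\<in>UNIV. R j (f j) x)" if f: "f \<in> nonneg_tuples Y" for f
  proof -
    \<comment> \<open>Each choice of weights brings its own null set. Rational weights on a finite
      index type are countably many, so one null set serves them all.\<close>
    have "AE x in \<mu>. \<forall>a::'d \<Rightarrow> rat. (\<forall>j. 0 < a j) \<longrightarrow>
        real CARD('d) * root CARD('d) (\<Prod>j\<in>UNIV. of_rat (a j)) * (w x * root CARD('d) (T f x))
          \<le> (\<Sum>j\<in>UNIV. of_rat (a j) * r j (f j) x)"
      unfolding AE_all_countable
    proof
      fix a :: "'d \<Rightarrow> rat"
      show "AE x in \<mu>. (\<forall>j. 0 < a j) \<longrightarrow>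
        real CARD('d) * root CARD('d) (\<Prod>j\<in>UNIV. of_rat (a j)) * (w x * root CARD('d) (T f x))
          \<le> (\<Sum>j\<in>UNIV. of_rat (a j) * r j (f j) x)"
      proof (cases "\<forall>j. 0 < a j")
        case True
        then have a: "0 < real_of_rat (a j)" "0 \<le> real_of_rat (a j)" for j by (simp_all add: less_imp_le)
        have "AE x in \<mu>. \<forall>j. r j (real_of_rat (a j) *\<^sub>R f j) x = real_of_rat (a j) * r j (f j) x"
          unfolding AE_all_countable by (intro allI r_scale nonneg_tuplesD(1)[OF f] nonneg_tuplesD(2)[OF f] a)
        moreover note mean[OF scale_nonneg_tuples[OF f, of "\<lambda>j. of_rat (a j)", OF a(2)]]
          T_scale[OF f, of "\<lambda>j. of_rat (a j)", OF a(2)]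
        ultimately show ?thesis
          by eventually_elim (simp add: real_root_mult mult_ac)
      next
        case False
        show ?thesis by (rule AE_I2) (use False in blast)
      qed
    qed
    moreover have "AE x in \<mu>. \<forall>j. R j (f j) x = r j (f j) x"
      unfolding AE_all_countable by (intro allI R_nonneg nonneg_tuplesD(1)[OF f] nonneg_tuplesD(2)[OF f])
    ultimately show ?thesis using T_nonneg[OF f] weight_nonneg
    proof eventually_elim
      case (elim x)
      have "(w x * root CARD('d) (T f x)) ^ CARD('d) \<le> (\<Prod>j\<in>UNIV. r j (f j) x)"
        using elim by (intro power_le_prod_of_rat_weights r_nonneg nonneg_tuplesD(1)[OF f] nonneg_tuplesD(2)[OF f]) auto
      with elim show ?case by (simp add: power_mult_distrib)
    qed
  qed
  with R_op R_int R_le show ?thesis by (intro exI[of _ R]) blast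
qed

end

theorem theorem1:
  fixes \<mu> :: "'a measure"
    and Y :: "'d::finite \<Rightarrow> 'y::{ordered_real_vector, lattice_ab_group_add_abs} set"
    and N :: "'d \<Rightarrow> 'y \<Rightarrow> real"
    and T :: "('d \<Rightarrow> 'y) \<Rightarrow> 'a \<Rightarrow> real"
    and q q' :: ennreal
    and A B :: real
    and M :: "'a \<Rightarrow> real"
  assumes "sigma_finite_measure \<mu>"
    and "\<And>j. normed_lattice (Y j) (N j)"
    and "positive_multilinear_op \<mu> Y T"
    and "saturates \<mu> Y T"
    and "1 \<le> q" and "q < top" and "1 / q + 1 / q' = 1"
    and "0 \<le> A" and "0 \<le> B"
    and "\<And>f. f \<in> nonneg_tuples Y \<Longrightarrow>
           (\<lambda>x. root CARD('d) (T f x)) \<in> Lp_space \<mu> q \<and>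
           Lp_norm \<mu> q (\<lambda>x. root CARD('d) (T f x)) \<le> A * root CARD('d) (\<Prod>j\<in>UNIV. N j (f j))"
    and "structural_hypothesis \<mu> Y N T B"
    and "M \<in> Lp_space \<mu> q'" and "AE x in \<mu>. 0 \<le> M x" and "Lp_norm \<mu> q' M = 1"
  shows "\<exists>R. (\<forall>j. positive_linear_op \<mu> (Y j) (R j) \<and> (\<forall>f\<in>Y j. R j f \<in> Lp_space \<mu> 1)) \<and>
           (\<forall>f\<in>nonneg_tuples Y.
              AE x in \<mu>. M x ^ CARD('d) * T f x \<le> (\<Prod>j\<in>UNIV. R j (f j) x)) \<and>
           (\<forall>j. L1_op_norm \<mu> (Y j) (N j) (R j) \<le> ennreal (A * B))"
proof -
  have pos: "AE x in \<mu>. 0 \<le> root CARD('d) (T f x)" if "f \<in> nonneg_tuples Y" for f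
    using assms(3) that by (auto simp: positive_multilinear_op_def elim: eventually_mono)
  \<comment> \<open>Since \<open>M\<close> has norm one, the bound on the norm of the root of
    \<open>T f\<close> becomes a bound on its integral against \<open>M\<close> with the same
    constant \<open>A\<close>; from here on \<open>M\<close> acts only as the weight.\<close>
  note Hoelder = Hoelder_normalised[OF assms(5-7,12-14) conjunct1[OF assms(10)] pos]
  interpret sigma_finite_measure \<mu> by fact
  interpret weighted_structure \<mu> Y N T M A B
    using assms(2,3,8,9,11,13) Hoelder(1) order_trans[OF Hoelder(2) conjunct2[OF assms(10)]]
    by unfold_locales auto
  obtain R where R: "\<And>j. positive_linear_op \<mu> (Y j) (R j)"
      "\<And>j f. f \<in> Y j \<Longrightarrow> integrable \<mu> (R j f)"
      "\<And>j f. f \<in> Y j \<Longrightarrow> (\<integral>x. \<bar>R j f x\<bar> \<partial>\<mu>) \<le> A * B * N j f"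
      "\<And>f. f \<in> nonneg_tuples Y \<Longrightarrow> AE x in \<mu>. M x ^ CARD('d) * T f x \<le> (\<Prod>j\<in>UNIV. R j (f j) x)"
    using exists_factorisation by blast
  have L1: "R j f \<in> Lp_space \<mu> 1" "Lp_norm \<mu> 1 (R j f) = (\<integral>x. \<bar>R j f x\<bar> \<partial>\<mu>)" if "f \<in> Y j" for j f
    using R(2)[OF that] by (simp_all add: Lp_space_def Lp_norm_def)
  have "L1_op_norm \<mu> (Y j) (N j) (R j) \<le> ennreal (A * B)" for j
    unfolding L1_op_norm_def
  proof (rule SUP_least)
    fix f assume "f \<in> {f \<in> Y j. N j f \<le> 1}"
    then have f: "f \<in> Y j" "N j f \<le> 1" by auto
    have "Lp_norm \<mu> 1 (R j f) \<le> A * B * N j f" using L1(2)[OF f(1)] R(3)[OF f(1)] by simp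
    also have "\<dots> \<le> A * B * 1" using f(2) assms(8,9) by (intro mult_left_mono) auto
    finally show "ennreal (Lp_norm \<mu> 1 (R j f)) \<le> ennreal (A * B)" by (simp add: ennreal_leI)
  qed
  with R L1(1) show ?thesis by (intro exI[of _ R]) blast
qed

end
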